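(* Let $n\ge 1$, let $\alpha\ge 1$, and let $(Q_1,\ldots,Q_n)$ be an $\alpha$-conditioned doubly stochastic $n$-tuple of positive definite real symmetric $n\times n$ matrices. Then $$D(Q_1,\ldots,Q_n)\ \le\ n^{\alpha^4}e^{-(n-1)}.$$
   Context: For real symmetric $n\times n$ matrices $Q_1,\ldots,Q_n$, the mixed discriminant is $D(Q_1,\ldots,Q_n)=\frac{\partial^n}{\partial t_1\cdots\partial t_n}\det(t_1Q_1+\cdots+t_nQ_n)$, i.e. the coefficient of $t_1\cdots t_n$ in the homogeneous polynomial $\det(t_1Q_1+\cdots+t_nQ_n)$. An $n$-tuple $(Q_1,\ldots,Q_n)$ of positive semidefinite $n\times n$ matrices is doubly stochastic if $Q_1+\cdots+Q_n=I$ (the identity matrix) and $\operatorname{tr}Q_1=\cdots=\operatorname{tr}Q_n=1$. For $\alpha\ge1$, an $n$-tuple of positive definite matrices is $\alpha$-conditioned if $\lambda_{\max}(Q_i)\le\alpha\,\lambda_{\min}(Q_j)$ for all $1\le i,j\le n$ (including $i=j$), where $\lambda_{\max},\lambda_{\min}$ denote the largest and smallest eigenvalues. *)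

theory Defs
  imports "HOL-Analysis.Analysis"
begin

fun pderivs :: "nat \<Rightarrow> ((nat \<Rightarrow> real) \<Rightarrow> real) \<Rightarrow> (nat \<Rightarrow> real) \<Rightarrow> real" where
  "pderivs 0 f = f"
| "pderivs (Suc k) f = (\<lambda>t. deriv (\<lambda>s. pderivs k f (t(k := s))) (t k))"

text \<open>Mixed discriminant of the n-tuple Q 0, ..., Q (n-1) of n x n matrices, n = CARD('n):
  the derivative d^n / (dt_1 ... dt_n) of det(t_1 Q_1 + ... + t_n Q_n) (a constant,
  evaluated at t = 0).\<close>
definition mixed_discr :: "(nat \<Rightarrow> real^'n^'n) \<Rightarrow> real" where
  "mixed_discr Q = pderivs CARD('n) (\<lambda>t. det (\<Sum>i<CARD('n). t i *\<^sub>R Q i)) (\<lambda>_. 0)"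

definition symmetric_mat :: "real^'n^'n \<Rightarrow> bool" where
  "symmetric_mat A \<longleftrightarrow> transpose A = A"

definition pos_def :: "real^'n^'n \<Rightarrow> bool" where
  "pos_def A \<longleftrightarrow> symmetric_mat A \<and> (\<forall>x. x \<noteq> 0 \<longrightarrow> x \<bullet> (A *v x) > 0)"

definition eigenvalues :: "real^'n^'n \<Rightarrow> real set" where
  "eigenvalues A = {l. \<exists>v. v \<noteq> 0 \<and> A *v v = l *\<^sub>R v}"

definition lambda_max :: "real^'n^'n \<Rightarrow> real" where
  "lambda_max A = Max (eigenvalues A)"

definition lambda_min :: "real^'n^'n \<Rightarrow> real" where
  "lambda_min A = Min (eigenvalues A)"

definition doubly_stochastic :: "(nat \<Rightarrow> real^'n^'n) \<Rightarrow> bool" where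
  "doubly_stochastic Q \<longleftrightarrow>
     (\<forall>i<CARD('n). symmetric_mat (Q i) \<and> (\<forall>x. x \<bullet> (Q i *v x) \<ge> 0)) \<and>
     (\<Sum>i<CARD('n). Q i) = mat 1 \<and>
     (\<forall>i<CARD('n). trace (Q i) = 1)"

definition alpha_conditioned :: "real \<Rightarrow> (nat \<Rightarrow> real^'n^'n) \<Rightarrow> bool" where
  "alpha_conditioned \<alpha> Q \<longleftrightarrow>
     (\<forall>i<CARD('n). pos_def (Q i)) \<and>
     (\<forall>i<CARD('n). \<forall>j<CARD('n). lambda_max (Q i) \<le> \<alpha> * lambda_min (Q j))"

end

theory Submission
  imports Defs "HOL-Computational_Algebra.Fundamental_Theorem_Algebra"
begin

text \<open>The proof follows Gurvits' capacity method.  Let \<open>F z = det (z\<^sub>0 Q\<^sub>0 + \<dots> + z\<^bsub>n-1\<^esub> Q\<^bsub>n-1\<^esub>)\<close> for complex \<open>z\<close>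
  and differentiate away one variable after the other, setting it to 0.  By the Gauss--Lucas argument
  each polynomial \<open>G\<^sub>j\<close> so obtained is nonzero wherever \<open>\<Sum> Re z\<^sub>i Q\<^sub>i\<close> is positive definite.  Maximize
  \<open>(\<Prod> t\<^sub>i) / G\<^sub>j t\<close> over the positive orthant; at the maximum \<open>t\<^sub>i \<partial>\<^sub>i G\<^sub>j = G\<^sub>j\<close> for all remaining \<open>i\<close>, and
  since \<open>Q\<^sub>i \<le> \<alpha> Q\<^sub>l\<close> gives \<open>\<partial>\<^sub>i G\<^sub>j \<le> \<alpha> \<partial>\<^sub>l G\<^sub>j\<close>, the \<open>t\<^sub>i\<close> differ by factors of at most \<open>\<alpha>\<close>.  With \<open>k = n - j\<close>
  variables left, \<open>G\<^sub>j\<close> restricted to a multiple \<open>s t\<^sub>j\<close> of its first variable is a real-rooted polynomial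
  \<open>c \<Prod>(1 - \<lambda>\<^sub>i + s \<lambda>\<^sub>i)\<close> with \<open>\<Sum> \<lambda>\<^sub>i = 1\<close> and \<open>0 < \<lambda>\<^sub>i \<le> \<alpha>\<^sup>2 / k\<close>, whose derivative at 0 is at most
  \<open>c exp (\<alpha>\<^sup>2 / k - 1)\<close>.  Hence \<open>inf G\<^sub>j t / \<Prod> t\<^sub>i\<close> grows by at most this factor at each of the \<open>n - 1\<close>
  steps, starting from \<open>det I = 1\<close> and ending with the mixed discriminant.\<close>

section \<open>Univariate polynomials with roots in a half-plane\<close>

lemma poly_pderiv_roots:
  fixes r :: "nat \<Rightarrow> 'a::field_char_0"
  assumes "p = smult c (\<Prod>i<d. [:- r i, 1:])" and "poly p s \<noteq> 0"
  shows "poly (pderiv p) s = poly p s * (\<Sum>i<d. 1 / (s - r i))"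
proof -
  have "s - r i \<noteq> 0" if "i < d" for i
    using assms that by (auto simp: poly_prod)
  then have "poly (pderiv (\<Prod>i<d. [:- r i, 1:])) s =
      poly (\<Prod>i<d. [:- r i, 1:]) s * (\<Sum>i<d. 1 / (s - r i))"
  proof (induction d)
    case (Suc d)
    then have "s - r d \<noteq> 0" by blast
    with Suc have IH: "poly (pderiv (\<Prod>i<d. [:- r i, 1:])) s =
      poly (\<Prod>i<d. [:- r i, 1:]) s * (\<Sum>i<d. 1 / (s - r i))" by simp
    show ?case
      unfolding prod.lessThan_Suc pderiv_mult poly_add poly_mult IH sum.lessThan_Suc
      using \<open>s - r d \<noteq> 0\<close> by (simp add: pderiv_pCons divide_simps) (simp add: algebra_simps)
  qed simp
  then show ?thesis
    by (simp add: assms(1) pderiv_smult)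
qed

text \<open>Gauss-Lucas: the logarithmic derivative at 0 is the sum of \<open>1 / (0 - r i)\<close>
  over the roots, and each term has positive real part because \<open>Re (r i) < 0\<close>. A
  nonzero degree makes the sum nonempty, hence strictly positive.\<close>

lemma Re_logderiv_half_plane:
  fixes p :: "complex poly"
  assumes nz: "\<And>s. Re s \<ge> 0 \<Longrightarrow> poly p s \<noteq> 0"
  shows "Re (poly (pderiv p) 0 / poly p 0) \<ge> 0"
    and "degree p \<noteq> 0 \<Longrightarrow> Re (poly (pderiv p) 0 / poly p 0) > 0"
proof -
  obtain r where r: "smult (lead_coeff p) (\<Prod>i<degree p. [:- r i, 1:]) = p"
    using complex_poly_decompose' by blast
  have neg: "Re (r i) < 0" if "i < degree p" for i
  proof (rule ccontr)
    assume "\<not> Re (r i) < 0"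
    then have "poly p (r i) \<noteq> 0" using nz by simp
    moreover have "poly p (r i) = 0"
      using that by (subst r[symmetric]) (auto simp: poly_prod intro!: disjI2)
    ultimately show False by simp
  qed
  have eq: "poly (pderiv p) 0 / poly p 0 = (\<Sum>i<degree p. 1 / (0 - r i))"
    using poly_pderiv_roots[OF r[symmetric], of 0] nz[of 0] by (simp add: field_simps)
  have pos: "Re (1 / (0 - r i)) > 0" if "i < degree p" for i
  proof -
    have "(Re (r i))\<^sup>2 + (Im (r i))\<^sup>2 > 0"
      using neg[OF that] by (intro add_pos_nonneg) auto
    then show ?thesis using neg[OF that] by (simp add: Re_divide divide_neg_pos)
  qed
  show "Re (poly (pderiv p) 0 / poly p 0) \<ge> 0"
    unfolding eq Re_sum using pos by (intro sum_nonneg less_imp_le) auto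
  show "Re (poly (pderiv p) 0 / poly p 0) > 0" if "degree p \<noteq> 0"
    unfolding eq Re_sum using pos that by (intro sum_pos) auto
qed

text \<open>The left side is the sum over \<open>i\<close> of \<open>l i\<close> times the product
  of the other factors \<open>1 - l k\<close>. Since \<open>1 - x \<le> exp (- x)\<close>, that
  product is at most \<open>exp (l i - S)\<close> with \<open>S\<close> the sum of all
  \<open>l k\<close>, and \<open>l i \<le> m\<close>. The induction adds one factor at a
  time.\<close>

lemma prod_one_minus_sum_bound:
  fixes l :: "nat \<Rightarrow> real"
  assumes "\<And>i. i < d \<Longrightarrow> 0 < l i" "\<And>i. i < d \<Longrightarrow> l i < 1" "\<And>i. i < d \<Longrightarrow> l i \<le> m" "0 \<le> m"
  shows "(\<Prod>i<d. 1 - l i) * (\<Sum>i<d. l i / (1 - l i)) \<le> exp (m - (\<Sum>i<d. l i)) * (\<Sum>i<d. l i)"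
  using assms
proof (induction d)
  case (Suc d)
  let ?P = "\<Prod>i<d. 1 - l i" and ?S = "\<Sum>i<d. l i" and ?E = "\<Sum>i<d. l i / (1 - l i)"
  have l: "0 < l d" "l d < 1" "l d \<le> m"
    using Suc.prems by auto
  have S: "0 \<le> ?S"
    using Suc.prems(1) by (intro sum_nonneg) (simp add: less_imp_le)
  have P: "?P \<le> exp (- ?S)"
  proof -
    have "?P \<le> (\<Prod>i<d. exp (- l i))"
    proof (intro prod_mono conjI)
      fix i assume "i \<in> {..<d}"
      then show "0 \<le> 1 - l i" using Suc.prems(2)[of i] by simp
      show "1 - l i \<le> exp (- l i)" using exp_ge_add_one_self[of "- l i"] by simp
    qed
    also have "\<dots> = exp (- ?S)" by (simp add: exp_sum sum_negf[symmetric])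
    finally show ?thesis .
  qed
  have IH: "?P * ?E \<le> exp (m - ?S) * ?S" using Suc by simp
  have "(\<Prod>i<Suc d. 1 - l i) * (\<Sum>i<Suc d. l i / (1 - l i)) = l d * ?P + (1 - l d) * (?P * ?E)"
    using l by (simp add: field_simps)
  also have "\<dots> \<le> l d * exp (- ?S) + exp (- l d) * (exp (m - ?S) * ?S)"
  proof (intro add_mono mult_left_mono[OF P] mult_mono[OF _ IH])
    show "1 - l d \<le> exp (- l d)" using exp_ge_add_one_self[of "- l d"] by simp
    show "0 \<le> ?P * ?E"
      using Suc.prems by (intro mult_nonneg_nonneg prod_nonneg sum_nonneg) (auto simp: less_imp_le)
  qed (use l in auto)
  also have "\<dots> = exp (- l d - ?S) * (l d * exp (l d) + exp m * ?S)"
    by (simp add: algebra_simps exp_add[symmetric] exp_diff exp_minus field_simps)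
  also have "\<dots> \<le> exp (- l d - ?S) * (l d * exp m + exp m * ?S)"
    using l by (intro mult_left_mono add_mono) auto
  also have "\<dots> = exp (m - (\<Sum>i<Suc d. l i)) * (\<Sum>i<Suc d. l i)"
    by (simp add: algebra_simps exp_add[symmetric] exp_diff exp_minus field_simps)
  finally show ?case .
qed simp

text \<open>With roots \<open>- \<rho>\<^sub>i\<close>, put \<open>\<lambda>\<^sub>i = 1 / (1 + \<rho>\<^sub>i)\<close>; the hypotheses say that the \<open>\<lambda>\<^sub>i\<close> sum to 1
  and are at most \<open>m\<close>, and \<open>p'(0) / p(1) = (\<Prod>i. 1 - \<lambda>\<^sub>i) (\<Sum>i. \<lambda>\<^sub>i / (1 - \<lambda>\<^sub>i))\<close>.\<close>
lemma real_rooted_deriv_bound: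
  fixes p :: "complex poly"
  assumes real: "\<And>s. Im s \<noteq> 0 \<Longrightarrow> poly p s \<noteq> 0"
    and nonneg: "\<And>s. Re s \<ge> 0 \<Longrightarrow> poly p s \<noteq> 0"
    and right: "\<And>s. Re s > 1 - 1 / m \<Longrightarrow> poly p s \<noteq> 0"
    and m: "m > 0"
    and p1: "poly p 1 = of_real c" "c > 0"
    and dp1: "poly (pderiv p) 1 = poly p 1"
  shows "Re (poly (pderiv p) 0) \<le> exp (m - 1) * c"
proof -
  define d where "d = degree p"
  obtain r where r: "smult (lead_coeff p) (\<Prod>i<d. [:- r i, 1:]) = p"
    using complex_poly_decompose' d_def by blast
  define l where "l = (\<lambda>i. 1 / (1 - Re (r i)))"
  have root: "poly p (r i) = 0" if "i < d" for i
    using that by (subst r[symmetric]) (auto simp: poly_prod intro!: disjI2)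
  have r_real: "r i = of_real (Re (r i))" if "i < d" for i
    using real root[OF that] by (auto simp: complex_eq_iff)
  have r_neg: "Re (r i) < 0" if "i < d" for i
    using nonneg root[OF that] by (meson not_less)
  have r_right: "Re (r i) \<le> 1 - 1 / m" if "i < d" for i
    using right root[OF that] by (meson not_less)
  have l: "0 < l i" "l i < 1" "l i \<le> m" if "i < d" for i
  proof -
    show "0 < l i" "l i < 1" using r_neg[OF that] by (auto simp: l_def)
    show "l i \<le> m"
      using r_neg[OF that] r_right[OF that] m by (simp add: l_def field_simps)
  qed
  have l_c: "1 / (1 - r i) = of_real (l i)" if "i < d" for i
    by (subst r_real[OF that]) (simp add: l_def)
  have "poly p 1 * (\<Sum>i<d. 1 / (1 - r i)) = poly p 1"
    using poly_pderiv_roots[OF r[symmetric], of 1] dp1 nonneg[of 1] by simp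
  then have "(\<Sum>i<d. 1 / (1 - r i)) = 1" using nonneg[of 1] by simp
  also have "(\<Sum>i<d. 1 / (1 - r i)) = of_real (\<Sum>i<d. l i)"
    using l_c by simp
  finally have sum1: "(\<Sum>i<d. l i) = 1" using of_real_eq_1_iff by blast
  have p_eq: "poly p s = lead_coeff p * (\<Prod>i<d. s - r i)" for s
    by (subst r[symmetric]) (simp add: poly_prod)
  \<comment> \<open>As \<open>l i = 1 / (1 - r i)\<close>, every factor satisfies
    \<open>- r i = (1 - r i) * (1 - l i)\<close>, which relates the value at 0 to the value
    \<open>c\<close> at 1.\<close>
  have "(\<Prod>i<d. 0 - r i) = (\<Prod>i<d. (1 - r i) * of_real (1 - l i))"
  proof (intro prod.cong refl)
    fix i assume "i \<in> {..<d}"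
    then have i: "i < d" by simp
    have "1 - r i \<noteq> 0" using r_neg[OF i] by (auto simp: complex_eq_iff)
    then show "0 - r i = (1 - r i) * of_real (1 - l i)"
      using l_c[OF i] by (simp add: field_simps)
  qed
  then have p0: "poly p 0 = of_real (c * (\<Prod>i<d. 1 - l i))"
    unfolding p_eq[of 0] using p1(1) p_eq[of 1] by (simp add: prod.distrib mult.assoc)
  have "(\<Sum>i<d. 1 / (0 - r i)) = of_real (\<Sum>i<d. l i / (1 - l i))"
    unfolding of_real_sum
  proof (intro sum.cong refl)
    fix i assume "i \<in> {..<d}"
    then have i: "i < d" by simp
    have "l i / (1 - l i) = 1 / (- Re (r i))"
      using r_neg[OF i] by (simp add: l_def field_simps)
    then show "1 / (0 - r i) = of_real (l i / (1 - l i))"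
      by (subst r_real[OF i]) simp
  qed
  then have "poly (pderiv p) 0 = of_real (c * ((\<Prod>i<d. 1 - l i) * (\<Sum>i<d. l i / (1 - l i))))"
    using poly_pderiv_roots[OF r[symmetric], of 0] nonneg[of 0] p0 by simp
  then have "Re (poly (pderiv p) 0) = c * ((\<Prod>i<d. 1 - l i) * (\<Sum>i<d. l i / (1 - l i)))"
    by (simp only: Re_complex_of_real)
  also have "\<dots> \<le> c * (exp (m - (\<Sum>i<d. l i)) * (\<Sum>i<d. l i))"
    using prod_one_minus_sum_bound[of d l m] l m p1(2) by (intro mult_left_mono) auto
  finally show ?thesis by (simp add: sum1 mult.commute)
qed

section \<open>Real polynomial functions of several complex variables\<close>

text \<open>Polynomials are represented by closure rules on functions, so facts about restriction,
  continuity and differentiation follow by rule induction. Admitting only real constants makes the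
  values at real points real.\<close>

inductive real_polyfun :: "((nat \<Rightarrow> complex) \<Rightarrow> complex) \<Rightarrow> bool" where
  const: "real_polyfun (\<lambda>z. of_real c)"
| var: "real_polyfun (\<lambda>z. z i)"
| add: "real_polyfun f \<Longrightarrow> real_polyfun g \<Longrightarrow> real_polyfun (\<lambda>z. f z + g z)"
| mult: "real_polyfun f \<Longrightarrow> real_polyfun g \<Longrightarrow> real_polyfun (\<lambda>z. f z * g z)"

lemma real_polyfun_sum:
  "(\<And>x. x \<in> A \<Longrightarrow> real_polyfun (f x)) \<Longrightarrow> real_polyfun (\<lambda>z. \<Sum>x\<in>A. f x z)"
  by (induction A rule: infinite_finite_induct)
    (use real_polyfun.const[of 0] in \<open>auto intro: real_polyfun.add\<close>)

lemma real_polyfun_prod: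
  "(\<And>x. x \<in> A \<Longrightarrow> real_polyfun (f x)) \<Longrightarrow> real_polyfun (\<lambda>z. \<Prod>x\<in>A. f x z)"
  by (induction A rule: infinite_finite_induct)
    (use real_polyfun.const[of 1] in \<open>auto intro: real_polyfun.mult\<close>)

text \<open>Bridge to the univariate results: root arguments are applied to restrictions to complex
  lines.\<close>

lemma real_polyfun_line:
  assumes "real_polyfun f"
  obtains p where "\<And>s. f (\<lambda>i. a i + s * b i) = poly p s"
proof -
  have "\<exists>p. \<forall>s. f (\<lambda>i. a i + s * b i) = poly p s"
    using assms
  proof induction
    case (const c)
    show ?case by (rule exI[of _ "[:of_real c:]"]) simp
  next
    case (var i)
    show ?case by (rule exI[of _ "[:a i, b i:]"]) simp
  next
    case (add f g)
    then show ?case by (metis poly_add)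
  next
    case (mult f g)
    then show ?case by (metis poly_mult)
  qed
  then show thesis using that by blast
qed

lemma real_polyfun_of_real:
  assumes "real_polyfun f"
  shows "f (\<lambda>i. of_real (t i)) = of_real (Re (f (\<lambda>i. of_real (t i))))"
proof -
  have "f (\<lambda>i. of_real (t i)) \<in> \<real>"
    using assms by induction auto
  then show ?thesis by (simp add: of_real_Re)
qed

lemma continuous_on_real_polyfun:
  assumes "real_polyfun f"
  shows "continuous_on UNIV (\<lambda>t. Re (f (\<lambda>i. of_real (t i))))"
proof -
  have "continuous_on UNIV (\<lambda>t. f (\<lambda>i. complex_of_real (t i)))"
    using assms by induction (auto intro!: continuous_intros)
  then show ?thesis by (intro continuous_intros)
qed

section \<open>Partial derivatives of polynomial functions\<close>

definition partial_deriv ::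
    "nat \<Rightarrow> ((nat \<Rightarrow> complex) \<Rightarrow> complex) \<Rightarrow> (nat \<Rightarrow> complex) \<Rightarrow> complex" where
  "partial_deriv k f z = deriv (\<lambda>s. f (z(k := s))) (z k)"

lemma real_polyfun_partial_deriv:
  assumes "real_polyfun f"
  shows "real_polyfun (partial_deriv k f)"
    and "((\<lambda>s. f (z(k := s))) has_field_derivative partial_deriv k f z) (at (z k))"
proof -
  have "\<exists>f'. real_polyfun f' \<and>
      (\<forall>z. ((\<lambda>s. f (z(k := s))) has_field_derivative f' z) (at (z k)))"
    using assms
  proof induction
    case (const c)
    show ?case
      by (rule exI[of _ "\<lambda>z. 0"]) (use real_polyfun.const[of 0] in auto)
  next
    case (var i)
    show ?case
      by (rule exI[of _ "\<lambda>z. if i = k then 1 else 0"])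
        (use real_polyfun.const[of 0] real_polyfun.const[of 1] in auto)
  next
    case (add f g)
    then obtain f' g' where fg: "real_polyfun f'" "real_polyfun g'"
      "\<And>z. ((\<lambda>s. f (z(k := s))) has_field_derivative f' z) (at (z k))"
      "\<And>z. ((\<lambda>s. g (z(k := s))) has_field_derivative g' z) (at (z k))" by blast
    show ?case
      by (intro exI[of _ "\<lambda>z. f' z + g' z"] conjI allI real_polyfun.add DERIV_add fg)
  next
    case (mult f g)
    then obtain f' g' where fg: "real_polyfun f'" "real_polyfun g'"
      "\<And>z. ((\<lambda>s. f (z(k := s))) has_field_derivative f' z) (at (z k))"
      "\<And>z. ((\<lambda>s. g (z(k := s))) has_field_derivative g' z) (at (z k))" by blast
    show ?case
      by (intro exI[of _ "\<lambda>z. f' z * g z + g' z * f z"] conjI allI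
          real_polyfun.add real_polyfun.mult fg mult.hyps DERIV_cong[OF DERIV_mult[OF fg(3,4)]])
        simp
  qed
  then obtain f' where f': "real_polyfun f'"
      "\<And>z. ((\<lambda>s. f (z(k := s))) has_field_derivative f' z) (at (z k))" by blast
  then have "partial_deriv k f = f'"
    by (auto simp: partial_deriv_def fun_eq_iff intro: DERIV_imp_deriv)
  with f' show "real_polyfun (partial_deriv k f)"
    and "((\<lambda>s. f (z(k := s))) has_field_derivative partial_deriv k f z) (at (z k))"
    by auto
qed

text \<open>A chain rule in two coordinates. The induction provides one pair \<open>d\<close>,
  \<open>e\<close> serving all directions \<open>a\<close>, \<open>b\<close>; the unit directions
  then identify the pair with the partial derivatives.\<close>

lemma real_polyfun_directional:
  assumes "real_polyfun f" and "i \<noteq> j"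
  shows "((\<lambda>s. f (z(i := z i + s * a, j := z j + s * b))) has_field_derivative
    a * partial_deriv i f z + b * partial_deriv j f z) (at 0)"
proof -
  have "\<exists>d e. \<forall>a b. ((\<lambda>s. f (z(i := z i + s * a, j := z j + s * b))) has_field_derivative
      a * d + b * e) (at 0)"
    using assms(1)
  proof induction
    case (const c)
    show ?case by (intro exI[of _ 0]) simp
  next
    case (var k)
    show ?case
      by (rule exI[of _ "if k = i then 1 else 0"], rule exI[of _ "if k = j then 1 else 0"])
        (use assms(2) in \<open>auto intro!: derivative_eq_intros\<close>)
  next
    case (add f g)
    then obtain d e d' e' where
      f: "\<And>a b. ((\<lambda>s. f (z(i := z i + s * a, j := z j + s * b))) has_field_derivative
        a * d + b * e) (at 0)" and
      g: "\<And>a b. ((\<lambda>s. g (z(i := z i + s * a, j := z j + s * b))) has_field_derivative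
        a * d' + b * e') (at 0)" by blast
    show ?case
      by (intro exI[of _ "d + d'"] exI[of _ "e + e'"] allI DERIV_cong[OF DERIV_add[OF f g]])
        (simp add: algebra_simps)
  next
    case (mult f g)
    then obtain d e d' e' where
      f: "\<And>a b. ((\<lambda>s. f (z(i := z i + s * a, j := z j + s * b))) has_field_derivative
        a * d + b * e) (at 0)" and
      g: "\<And>a b. ((\<lambda>s. g (z(i := z i + s * a, j := z j + s * b))) has_field_derivative
        a * d' + b * e') (at 0)" by blast
    show ?case
      by (intro exI[of _ "d * g z + d' * f z"] exI[of _ "e * g z + e' * f z"] allI
          DERIV_cong[OF DERIV_mult[OF f g]])
        (simp add: algebra_simps)
  qed
  then obtain d e where de: "\<And>a b. ((\<lambda>s. f (z(i := z i + s * a, j := z j + s * b))) has_field_derivative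
      a * d + b * e) (at 0)" by blast
  have part: "partial_deriv k f z = c"
    if "((\<lambda>s. f (z(k := z k + s))) has_field_derivative c) (at 0)" for k c
  proof -
    have "((\<lambda>s. f (z(k := z k + s))) has_field_derivative partial_deriv k f z) (at 0)"
      using real_polyfun_partial_deriv(2)[OF assms(1), of z k]
        DERIV_shift[of "\<lambda>s. f (z(k := s))" "partial_deriv k f z" 0 "z k"]
      by (simp add: add.commute)
    then show ?thesis using that DERIV_unique by blast
  qed
  have upd: "z(i := u, j := z j) = z(i := u)" "z(i := z i, j := u) = z(j := u)" for u
    using assms(2) by (auto simp: fun_eq_iff)
  have "partial_deriv i f z = d" using de[of 1 0] by (intro part) (simp add: upd)
  moreover have "partial_deriv j f z = e" using de[of 0 1] by (intro part) (simp add: upd)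
  ultimately show ?thesis using de by simp
qed

text \<open>Complex counterpart of \<open>pderivs\<close>. The variables already differentiated
  remain arguments; they are set to 0 only at evaluation.\<close>

primrec iter_partial ::
    "nat \<Rightarrow> ((nat \<Rightarrow> complex) \<Rightarrow> complex) \<Rightarrow> (nat \<Rightarrow> complex) \<Rightarrow> complex" where
  "iter_partial 0 f = f"
| "iter_partial (Suc k) f = partial_deriv k (iter_partial k f)"

lemma real_polyfun_iter_partial: "real_polyfun f \<Longrightarrow> real_polyfun (iter_partial k f)"
  by (induction k) (auto intro: real_polyfun_partial_deriv(1))

lemma real_polyfun_real_deriv:
  assumes "real_polyfun f"
  shows "((\<lambda>s. Re (f (\<lambda>i. of_real ((t(k := s)) i)))) has_field_derivative
    Re (partial_deriv k f (\<lambda>i. of_real (t i)))) (at (t k))"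
proof -
  let ?z = "\<lambda>i. complex_of_real (t i)"
  have "((\<lambda>s. f (?z(k := of_real s))) has_vector_derivative partial_deriv k f ?z) (at (t k))"
    using has_vector_derivative_real_field[OF real_polyfun_partial_deriv(2)[OF assms, of ?z k]]
    by simp
  then have "((\<lambda>s. Re (f (?z(k := of_real s)))) has_vector_derivative Re (partial_deriv k f ?z)) (at (t k))"
    by (rule bounded_linear.has_vector_derivative[OF bounded_linear_Re])
  moreover have "(?z(k := of_real s)) = (\<lambda>i. of_real ((t(k := s)) i))" for s
    by auto
  ultimately show ?thesis
    by (simp add: has_real_derivative_iff_has_vector_derivative)
qed

text \<open>Transfers the real iterated derivative in \<open>mixed_discr\<close> to the complex one,
  for which zero-free regions are available.\<close>

lemma pderivs_iter_partial:
  assumes "real_polyfun f"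
  shows "pderivs k (\<lambda>t. Re (f (\<lambda>i. of_real (t i)))) t = Re (iter_partial k f (\<lambda>i. of_real (t i)))"
proof (induction k arbitrary: t)
  case (Suc k)
  have "pderivs (Suc k) (\<lambda>t. Re (f (\<lambda>i. of_real (t i)))) t =
      deriv (\<lambda>s. Re (iter_partial k f (\<lambda>i. of_real ((t(k := s)) i)))) (t k)"
    using Suc by simp
  also have "\<dots> = Re (iter_partial (Suc k) f (\<lambda>i. of_real (t i)))"
    using real_polyfun_real_deriv[OF real_polyfun_iter_partial[OF assms]]
    by (simp add: DERIV_imp_deriv)
  finally show ?case .
qed simp

section \<open>The capacity recursion\<close>

lemma sum_fun_upd:
  fixes f :: "nat \<Rightarrow> 'a \<Rightarrow> 'b::comm_monoid_add"
  assumes "finite A" "j \<in> A"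
  shows "(\<Sum>i\<in>A. f i ((z(j := s)) i)) = f j s + (\<Sum>i\<in>A - {j}. f i (z i))"
proof -
  have "(\<Sum>i\<in>A. f i ((z(j := s)) i)) = f j s + (\<Sum>i\<in>A - {j}. f i ((z(j := s)) i))"
    using sum.remove[OF assms, of "\<lambda>i. f i ((z(j := s)) i)"] by simp
  also have "(\<Sum>i\<in>A - {j}. f i ((z(j := s)) i)) = (\<Sum>i\<in>A - {j}. f i (z i))"
    by (intro sum.cong) auto
  finally show ?thesis .
qed

lemma sum_if_times:
  fixes f :: "nat \<Rightarrow> 'a::semiring_0"
  assumes "k < n"
  shows "(\<Sum>i<n. (if i = k then a else 0) * f i) = a * f k"
proof -
  have "(\<Sum>i<n. (if i = k then a else 0) * f i) = (\<Sum>i<n. if i = k then a * f i else 0)"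
    by (intro sum.cong) auto
  then show ?thesis using assms by simp
qed

text \<open>The simplex is a closed subset of the cube of all functions into \<open>{0..1}\<close>,
  which is compact by Tychonoff.\<close>

lemma compact_nat_simplex:
  fixes A :: "nat set"
  assumes "finite A"
  shows "compact {t. (\<forall>i. i \<notin> A \<longrightarrow> t i = 0) \<and> (\<forall>i. 0 \<le> t i) \<and> (\<Sum>i\<in>A. t i) = (1::real)}"
    (is "compact ?K")
proof -
  have "compactin (product_topology (\<lambda>i::nat. euclidean) UNIV) (PiE UNIV (\<lambda>_. {0..1::real}))"
    unfolding compactin_PiE by auto
  then have "compact (PiE UNIV (\<lambda>_::nat. {0..1::real}))"
    by (simp add: euclidean_product_topology)
  moreover have "closed ?K"
  proof -
    have coord: "continuous_on UNIV (\<lambda>t::nat \<Rightarrow> real. t i)" for i by simp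
    have "?K = (\<Inter>i\<in>- A. {t. t i = 0}) \<inter> (\<Inter>i. {t. 0 \<le> t i}) \<inter> {t. (\<Sum>i\<in>A. t i) = 1}"
      by auto
    also have "closed \<dots>"
      by (intro closed_Int closed_INT ballI closed_Collect_eq closed_Collect_le coord
          continuous_on_const continuous_on_sum)
    finally show ?thesis .
  qed
  moreover have "?K \<subseteq> PiE UNIV (\<lambda>_. {0..1})"
  proof
    fix t assume t: "t \<in> ?K"
    have "t i \<le> 1" for i
    proof (cases "i \<in> A")
      case True
      then have "t i \<le> (\<Sum>i\<in>A. t i)"
        using assms t by (intro member_le_sum) simp_all
      then show ?thesis using t by simp
    qed (use t in auto)
    with t show "t \<in> PiE UNIV (\<lambda>_. {0..1})" by (simp add: PiE_UNIV_domain)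
  qed
  ultimately show ?thesis
    using compact_Int_closed[of "PiE UNIV (\<lambda>_. {0..1})" ?K] by (simp only: inf.absorb2)
qed

text \<open>\<open>w i x\<close> stands for the value at \<open>x\<close> of the \<open>i\<close>-th quadratic form.\<close>
locale stable_polynomial =
  fixes n :: nat and w :: "nat \<Rightarrow> 'x \<Rightarrow> real" and X :: "'x set" and \<alpha> :: real
    and F :: "(nat \<Rightarrow> complex) \<Rightarrow> complex"
  assumes alpha: "\<alpha> \<ge> 1"
    and w_pos: "\<And>i x. i < n \<Longrightarrow> x \<in> X \<Longrightarrow> 0 < w i x"
    and w_le: "\<And>i l x. i < n \<Longrightarrow> l < n \<Longrightarrow> x \<in> X \<Longrightarrow> w i x \<le> \<alpha> * w l x"
    and F_poly: "real_polyfun F"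
    and F_hom: "\<And>c z. c \<noteq> 0 \<Longrightarrow> F (\<lambda>i. c * z i) = c ^ n * F z"
    and F_nonzero: "\<And>z. (\<And>i. n \<le> i \<Longrightarrow> z i = 0) \<Longrightarrow>
      (\<And>x. x \<in> X \<Longrightarrow> 0 < (\<Sum>i<n. Re (z i) * w i x)) \<Longrightarrow> F z \<noteq> 0"
    and F_one: "F (\<lambda>i. if i < n then 1 else 0) = 1"
begin

section \<open>Zero-free regions and positivity of the iterated derivatives\<close>

abbreviation G :: "nat \<Rightarrow> (nat \<Rightarrow> complex) \<Rightarrow> complex" where
  "G j \<equiv> iter_partial j F"

abbreviation g :: "nat \<Rightarrow> (nat \<Rightarrow> real) \<Rightarrow> real" where
  "g j t \<equiv> Re (G j (\<lambda>i. of_real (t i)))"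

text \<open>The domain on which \<open>G j\<close> is shown not to vanish: the first
  \<open>j\<close> variables are already eliminated, and the real parts of the coordinates combine
  the forms \<open>w i\<close> to a positive one.\<close>

definition region :: "nat \<Rightarrow> (nat \<Rightarrow> complex) \<Rightarrow> bool" where
  "region j z \<longleftrightarrow> (\<forall>i. i \<notin> {j..<n} \<longrightarrow> z i = 0) \<and>
     (\<forall>x\<in>X. 0 < (\<Sum>i<n. Re (z i) * w i x))"

definition orthant :: "nat \<Rightarrow> (nat \<Rightarrow> real) \<Rightarrow> bool" where
  "orthant j t \<longleftrightarrow> (\<forall>i. i \<notin> {j..<n} \<longrightarrow> t i = 0) \<and> (\<forall>i\<in>{j..<n}. 0 < t i)"

lemma G_poly: "real_polyfun (G j)"
  by (intro real_polyfun_iter_partial F_poly)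

lemma G_of_real: "G j (\<lambda>i. of_real (t i)) = of_real (g j t)"
  by (rule real_polyfun_of_real[OF G_poly])

lemma G_Suc_deriv:
  "((\<lambda>s. G j (z(j := s))) has_field_derivative G (Suc j) z) (at (z j))"
  using real_polyfun_partial_deriv(2)[OF G_poly] by simp

text \<open>Each differentiation lowers the degree of homogeneity by one, by the chain rule for
  \<open>s / c\<close>.\<close>

lemma G_hom:
  assumes "c \<noteq> 0" "j \<le> n"
  shows "G j (\<lambda>i. c * z i) = c ^ (n - j) * G j z"
  using assms(2)
proof (induction j arbitrary: z)
  case (Suc j)
  have "((\<lambda>s. G j ((\<lambda>i. c * z i)(j := s))) has_field_derivative G (Suc j) (\<lambda>i. c * z i)) (at (c * z j))"
    by (rule G_Suc_deriv)
  moreover have "(\<lambda>s. G j ((\<lambda>i. c * z i)(j := s))) = (\<lambda>s. c ^ (n - j) * G j (z(j := s / c)))"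
  proof
    fix s
    have eq: "(\<lambda>i. c * z i)(j := s) = (\<lambda>i. c * (z(j := s / c)) i)"
      using assms(1) by auto
    show "G j ((\<lambda>i. c * z i)(j := s)) = c ^ (n - j) * G j (z(j := s / c))"
      unfolding eq using Suc.prems by (intro Suc.IH) simp
  qed
  moreover have "((\<lambda>s. c ^ (n - j) * G j (z(j := s / c))) has_field_derivative
      c ^ (n - j) * (G (Suc j) z * (1 / c))) (at (c * z j))"
  proof (intro DERIV_cmult DERIV_chain2[where f = "\<lambda>s. G j (z(j := s))" and g = "\<lambda>s. s / c"])
    show "((\<lambda>s. G j (z(j := s))) has_field_derivative G (Suc j) z) (at (c * z j / c))"
      using G_Suc_deriv assms(1) by simp
    show "((\<lambda>s. s / c) has_field_derivative 1 / c) (at (c * z j))"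
      by (rule DERIV_cdivide) simp
  qed
  ultimately have "G (Suc j) (\<lambda>i. c * z i) = c ^ (n - j) * (G (Suc j) z * (1 / c))"
    by (simp only: DERIV_unique)
  also have "c ^ (n - j) = c * c ^ (n - Suc j)"
    using Suc.prems by (simp add: Suc_diff_Suc flip: power_Suc)
  finally show ?case using assms(1) by simp
qed (simp add: F_hom assms(1))

lemma G_zero:
  assumes "j < n"
  shows "G j (\<lambda>_. 0) = 0"
proof (rule ccontr)
  assume "G j (\<lambda>_. 0) \<noteq> 0"
  moreover have "G j (\<lambda>_. 0) = 2 ^ (n - j) * G j (\<lambda>_. 0)"
    using G_hom[of 2 j "\<lambda>_. 0"] assms by simp
  ultimately have "(2::complex) ^ (n - j) = 1" by simp
  then have "(2::real) ^ (n - j) = 1" by (metis norm_numeral norm_one norm_power)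
  moreover have "1 < (2::real) ^ (n - j)" using assms by (intro one_less_power) auto
  ultimately show False by simp
qed

text \<open>Moving along a direction with nonnegative form by any \<open>s\<close> in the closed
  right half-plane stays in the region. Thus \<open>G j\<close> on such a line has all its roots in
  the open left half-plane, as Gauss-Lucas requires.\<close>

lemma region_add:
  assumes "region j z" "\<And>i. i \<notin> {j..<n} \<Longrightarrow> v i = 0"
    and "\<And>x. x \<in> X \<Longrightarrow> 0 \<le> (\<Sum>i<n. v i * w i x)" and "Re s \<ge> 0"
  shows "region j (\<lambda>i. z i + s * of_real (v i))"
  unfolding region_def
proof (intro conjI ballI allI impI)
  fix x assume x: "x \<in> X"
  have "(\<Sum>i<n. Re (z i + s * of_real (v i)) * w i x) =
      (\<Sum>i<n. Re (z i) * w i x) + Re s * (\<Sum>i<n. v i * w i x)"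
    by (simp add: algebra_simps sum.distrib sum_distrib_left)
  moreover have "0 < (\<Sum>i<n. Re (z i) * w i x)" using assms(1) x by (simp add: region_def)
  ultimately show "0 < (\<Sum>i<n. Re (z i + s * of_real (v i)) * w i x)"
    using assms(3)[OF x] assms(4) by (simp add: add_pos_nonneg)
qed (use assms in \<open>auto simp: region_def\<close>)

lemma region_Suc_upd:
  assumes "region (Suc j) z" "j < n" "Re s \<ge> 0"
  shows "region j (z(j := s))"
proof -
  have z: "region j z" and zj: "z j = 0" using assms(1) by (auto simp: region_def)
  have "region j (\<lambda>i. z i + s * of_real (if i = j then 1 else 0))"
  proof (rule region_add[OF z])
    show "0 \<le> (\<Sum>i<n. (if i = j then 1 else 0) * w i x)" if "x \<in> X" for x
      using w_pos[OF assms(2) that] by (simp add: sum_if_times[OF assms(2)])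
  qed (use assms in auto)
  moreover have "(\<lambda>i. z i + s * of_real (if i = j then 1 else 0)) = z(j := s)"
    using zj by auto
  ultimately show ?thesis by simp
qed

lemma region_nonneg:
  assumes "\<And>i. i \<notin> {j..<n} \<Longrightarrow> t i = 0" "\<And>i. 0 \<le> t i" "l \<in> {j..<n}" "0 < t l"
  shows "region j (\<lambda>i. of_real (t i))"
  unfolding region_def
proof (intro conjI ballI allI impI)
  fix x assume x: "x \<in> X"
  have "0 < t l * w l x" using assms w_pos[of l x] x by simp
  also have "\<dots> \<le> (\<Sum>i<n. t i * w i x)"
  proof (rule member_le_sum)
    show "0 \<le> t i * w i x" if "i \<in> {..<n} - {l}" for i
      using assms(2)[of i] w_pos[OF _ x, of i] that by simp
  qed (use assms(3) in auto)
  finally show "0 < (\<Sum>i<n. Re (of_real (t i)) * w i x)" by simp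
qed (use assms in auto)

lemma region_orthant:
  assumes "orthant j t" "j < n"
  shows "region j (\<lambda>i. of_real (t i))"
proof (rule region_nonneg)
  show "0 \<le> t i" for i
    using assms(1) by (cases "i \<in> {j..<n}") (auto simp: orthant_def less_imp_le)
  show "t i = 0" if "i \<notin> {j..<n}" for i
    using assms(1) that by (simp add: orthant_def)
  show "j \<in> {j..<n}" "0 < t j" using assms by (auto simp: orthant_def)
qed

text \<open>As a polynomial in the \<open>j\<close>-th variable alone, \<open>G j\<close> has no
  root with nonnegative real part, and \<open>G (Suc j) z\<close> is its derivative at 0.
  Nonvanishing at level \<open>j\<close> is a hypothesis because \<open>G_nonzero\<close> is proved
  from this lemma by induction.\<close>

lemma G_logderiv:
  assumes "Suc j < n" "region (Suc j) z" and nz: "\<And>z. region j z \<Longrightarrow> G j z \<noteq> 0"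
  shows "0 < Re (G (Suc j) z / G j z)"
proof -
  obtain p where "\<And>s. G j (\<lambda>i. z i + s * (if i = j then 1 else 0)) = poly p s"
    using real_polyfun_line[OF G_poly, of j z "\<lambda>i. if i = j then 1 else 0"] by blast
  moreover have zj: "z j = 0" using assms(2) by (auto simp: region_def)
  have "(\<lambda>i. z i + s * (if i = j then 1 else 0)) = z(j := s)" for s
    using zj by auto
  ultimately have p: "G j (z(j := s)) = poly p s" for s by simp
  have p_nz: "poly p s \<noteq> 0" if "Re s \<ge> 0" for s
    unfolding p[symmetric] using nz region_Suc_upd assms that by simp
  txt \<open>If \<open>G j\<close> did not depend on the \<open>j\<close>-th variable, homogeneity and continuity would make it vanish at
    the \<open>j\<close>-th unit vector.\<close>
  have "degree p \<noteq> 0"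
  proof
    assume "degree p = 0"
    then obtain c where c: "\<And>s. poly p s = c" by (auto elim!: degree_eq_zeroE)
    obtain q where "\<And>e. G j (\<lambda>i. (if i = j then 1 else 0) + e * (if i = j then 0 else z i)) = poly q e"
      using real_polyfun_line[OF G_poly, of j "\<lambda>i. if i = j then 1 else 0" "\<lambda>i. if i = j then 0 else z i"]
      by blast
    moreover have "(\<lambda>i. (if i = j then 1 else 0) + e * (if i = j then 0 else z i)) =
        (\<lambda>i. e * z i)(j := 1)" for e
      by auto
    ultimately have q: "poly q e = G j ((\<lambda>i. e * z i)(j := 1))" for e by simp
    \<comment> \<open>Pulling out \<open>e\<close> leaves \<open>1 / e\<close> in the
      \<open>j\<close>-th coordinate, where the assumed constancy of \<open>p\<close> gives the
      value \<open>c\<close>.\<close>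
    have q_nz: "poly q e = e ^ (n - j) * c" if "e \<noteq> 0" for e
    proof -
      have eq: "(\<lambda>i. e * z i)(j := 1) = (\<lambda>i. e * (z(j := 1 / e)) i)" using that by auto
      have "G j ((\<lambda>i. e * z i)(j := 1)) = e ^ (n - j) * G j (z(j := 1 / e))"
        unfolding eq using assms(1) by (intro G_hom that) simp
      then show ?thesis by (simp add: q p c)
    qed
    have "((\<lambda>e. e ^ (n - j) * c) \<longlongrightarrow> 0 ^ (n - j) * c) (at 0)"
      by (intro tendsto_intros)
    moreover have "eventually (\<lambda>e. e ^ (n - j) * c = poly q e) (at 0)"
      using q_nz by (auto simp: eventually_at_filter)
    ultimately have "(poly q \<longlongrightarrow> 0 ^ (n - j) * c) (at 0)"
      by (blast intro: Lim_transform_eventually)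
    moreover have "(poly q \<longlongrightarrow> poly q 0) (at 0)" using poly_isCont isCont_def by blast
    ultimately have "poly q 0 = 0 ^ (n - j) * c" using LIM_unique by blast
    then have "G j ((\<lambda>i. 0)(j := 1)) = 0" using assms(1) by (simp add: q)
    moreover have "region j ((\<lambda>i. 0)(j := 1))"
    proof -
      have "region j (\<lambda>i. of_real (((\<lambda>i. 0)(j := 1)) i))"
        by (rule region_nonneg[where l = j]) (use assms(1) in auto)
      moreover have "(\<lambda>i. complex_of_real (((\<lambda>i. 0)(j := 1)) i)) = (\<lambda>i. 0)(j := 1)" by auto
      ultimately show ?thesis by simp
    qed
    ultimately show False using nz by simp
  qed
  then have "0 < Re (poly (pderiv p) 0 / poly p 0)"
    using Re_logderiv_half_plane(2) p_nz by blast
  moreover have "poly (pderiv p) 0 = G (Suc j) z"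
  proof (rule DERIV_unique[OF poly_DERIV])
    show "(poly p has_field_derivative G (Suc j) z) (at 0)"
      using G_Suc_deriv[of j z] by (simp add: p zj)
  qed
  moreover have "poly p 0 = G j z" using p[of 0] zj by (metis fun_upd_triv)
  ultimately show ?thesis by simp
qed

text \<open>A quotient with positive real part cannot be 0, so nonvanishing passes from each level
  to the next.\<close>

lemma G_nonzero:
  assumes "j < n" "region j z"
  shows "G j z \<noteq> 0"
  using assms
proof (induction j arbitrary: z)
  case 0
  then show ?case using F_nonzero by (simp add: region_def)
next
  case (Suc j)
  then have "0 < Re (G (Suc j) z / G j z)" by (intro G_logderiv) auto
  then show ?case by auto
qed

text \<open>At level 0 the real segment from the all-ones point, where \<open>F\<close> is 1, to
  \<open>t\<close> stays in the region; \<open>F\<close> is real and nonzero on it, so the sign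
  cannot change. At later levels the quotient of consecutive derivatives is real with positive real
  part.\<close>

lemma g_pos:
  assumes "j < n" "region j (\<lambda>i. of_real (t i))"
  shows "0 < g j t"
  using assms
proof (induction j)
  case zero: 0
  define e where "e = (\<lambda>i. if i < n then 1 else (0::real))"
  have e: "region 0 (\<lambda>i. of_real (e i))"
    using zero by (intro region_nonneg[of _ _ 0]) (auto simp: e_def)
  have F_e: "F (\<lambda>i. of_real (e i)) = 1"
    using F_one by (simp add: e_def if_distrib cong: if_cong)
  obtain p where p: "\<And>s. F (\<lambda>i. of_real (e i) + s * of_real (t i - e i)) = poly p s"
    using real_polyfun_line[OF F_poly, of "\<lambda>i. of_real (e i)" "\<lambda>i. of_real (t i - e i)"] by blast
  show ?case
  proof (rule ccontr)
    assume "\<not> 0 < g 0 t"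
    moreover have "poly p 1 = F (\<lambda>i. of_real (t i))" using p[of 1] by simp
    ultimately have 1: "Re (poly p (of_real 1)) \<le> 0" by simp
    have "poly p 0 = 1" using p[of 0] F_e by simp
    then have 0: "0 \<le> Re (poly p (of_real 0))" by simp
    have "continuous_on {0..1} (\<lambda>u::real. Re (poly p (of_real u)))"
      by (intro continuous_intros)
    then obtain u :: real where u: "0 \<le> u" "u \<le> 1" "Re (poly p (of_real u)) = 0"
      using IVT2'[of "\<lambda>u. Re (poly p (of_real u))" 1 0 0, OF 1 0] by auto
    define t' where "t' = (\<lambda>i. e i + u * (t i - e i))"
    have "region 0 (\<lambda>i. of_real (t' i))"
      unfolding region_def
    proof (intro conjI ballI allI impI)
      fix x assume x: "x \<in> X"
      have "(\<Sum>i<n. t' i * w i x) = (1 - u) * (\<Sum>i<n. e i * w i x) + u * (\<Sum>i<n. t i * w i x)"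
        by (simp add: t'_def algebra_simps sum.distrib sum_distrib_left sum_subtractf)
      moreover have "0 < (\<Sum>i<n. e i * w i x)" "0 < (\<Sum>i<n. t i * w i x)"
        using e zero(2) x by (auto simp: region_def)
      ultimately show "0 < (\<Sum>i<n. Re (of_real (t' i)) * w i x)"
        using u by (cases "u = 0") (auto intro!: add_nonneg_pos)
    qed (use e zero(2) in \<open>auto simp: region_def t'_def\<close>)
    then have "F (\<lambda>i. of_real (t' i)) \<noteq> 0" using G_nonzero[of 0] zero by simp
    moreover have "F (\<lambda>i. of_real (t' i)) = poly p (of_real u)"
      using p[of "of_real u"] by (simp add: t'_def)
    ultimately show False
      using G_of_real[of 0 t'] u(3) by simp
  qed
next
  case (Suc j)
  let ?z = "\<lambda>i. complex_of_real (t i)"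
  have "region j ?z" using Suc.prems(2) by (auto simp: region_def)
  then have "0 < g j t" using Suc by simp
  moreover have "0 < Re (G (Suc j) ?z / G j ?z)"
    using Suc.prems(1) by (intro G_logderiv[OF Suc.prems] G_nonzero) simp_all
  moreover have "G (Suc j) ?z / G j ?z = of_real (g (Suc j) t / g j t)"
    using G_of_real[of "Suc j" t] G_of_real[of j t] by (metis of_real_divide)
  ultimately show ?case
    by (simp only: Re_complex_of_real zero_less_divide_iff) linarith
qed

text \<open>Monotonicity: along a direction with nonnegative form, Gauss-Lucas gives a nonnegative
  logarithmic derivative, and \<open>g j t\<close> is positive.\<close>

lemma directional_deriv_nonneg:
  assumes "j < n" "region j (\<lambda>i. of_real (t i))"
    and "\<And>i. i \<notin> {j..<n} \<Longrightarrow> v i = 0"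
    and "\<And>x. x \<in> X \<Longrightarrow> 0 \<le> (\<Sum>i<n. v i * w i x)"
    and "((\<lambda>s. G j (\<lambda>i. of_real (t i) + s * of_real (v i))) has_field_derivative of_real d) (at 0)"
  shows "0 \<le> d"
proof -
  obtain p where p: "\<And>s. G j (\<lambda>i. of_real (t i) + s * of_real (v i)) = poly p s"
    using real_polyfun_line[OF G_poly, of j "\<lambda>i. of_real (t i)" "\<lambda>i. of_real (v i)"] by blast
  have "poly p s \<noteq> 0" if "Re s \<ge> 0" for s
    unfolding p[symmetric] using assms that by (intro G_nonzero region_add) auto
  then have "0 \<le> Re (poly (pderiv p) 0 / poly p 0)"
    by (rule Re_logderiv_half_plane(1))
  moreover have "poly (pderiv p) 0 = of_real d"
    by (rule DERIV_unique[OF poly_DERIV]) (use assms(5) in \<open>simp add: p\<close>)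
  moreover have "poly p 0 = of_real (g j t)"
    using p[of 0] G_of_real[of j t] by (simp only: mult_zero_left add_0_right)
  moreover have "0 < g j t" using g_pos assms by blast
  ultimately show ?thesis
    by (simp only: of_real_divide[symmetric] Re_complex_of_real zero_le_divide_iff) linarith
qed

text \<open>Monotonicity in the direction with \<open>\<alpha>\<close> at \<open>l\<close> and
  \<open>- 1\<close> at \<open>i\<close>, whose form \<open>\<alpha> * w l x - w i x\<close> is
  nonnegative by \<open>w_le\<close>.\<close>

lemma partial_le:
  assumes j: "j < n" and t: "region j (\<lambda>i. of_real (t i))" and i: "i \<in> {j..<n}" and l: "l \<in> {j..<n}"
  shows "Re (partial_deriv i (G j) (\<lambda>i. of_real (t i))) \<le>
    \<alpha> * Re (partial_deriv l (G j) (\<lambda>i. of_real (t i)))"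
proof -
  let ?z = "\<lambda>i. complex_of_real (t i)"
  define D where "D = (\<lambda>k. Re (partial_deriv k (G j) ?z))"
  have D: "partial_deriv k (G j) ?z = of_real (D k)" for k
    using real_polyfun_of_real[OF real_polyfun_partial_deriv(1)[OF G_poly]] by (simp add: D_def)
  show ?thesis
  proof (cases "i = l")
    \<comment> \<open>The two entries of the direction coincide here, so the unit direction at
      \<open>l\<close> is used; it gives \<open>0 \<le> D l\<close>, and
      \<open>\<alpha> \<ge> 1\<close> does the rest.\<close>
    case True
    define v where "v = (\<lambda>m. if m = l then 1 else (0::real))"
    have "0 \<le> D l"
    proof (rule directional_deriv_nonneg[OF j t, of v])
      show "0 \<le> (\<Sum>i<n. v i * w i x)" if "x \<in> X" for x
        using l w_pos[OF _ that, of l] by (simp add: v_def sum_if_times)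
      have "(\<lambda>i. ?z i + s * of_real (v i)) = ?z(l := s + ?z l)" for s by (auto simp: v_def)
      then show "((\<lambda>s. G j (\<lambda>i. of_real (t i) + s * of_real (v i))) has_field_derivative of_real (D l)) (at 0)"
        using real_polyfun_partial_deriv(2)[OF G_poly[of j], of ?z l]
          DERIV_shift[of "\<lambda>s. G j (?z(l := s))" "partial_deriv l (G j) ?z" 0 "?z l"]
        by (simp only: D add_0_left)
    qed (use l in \<open>auto simp: v_def\<close>)
    then have "1 * D l \<le> \<alpha> * D l" using alpha by (intro mult_right_mono)
    then show ?thesis using True by (simp add: D_def)
  next
    case False
    define v where "v = (\<lambda>m. (if m = l then \<alpha> else 0) + (if m = i then - 1 else (0::real)))"
    have "0 \<le> - D i + \<alpha> * D l"
    proof (rule directional_deriv_nonneg[OF j t, of v])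
      show "0 \<le> (\<Sum>i<n. v i * w i x)" if "x \<in> X" for x
        unfolding v_def distrib_right sum.distrib using i l w_le[OF _ _ that, of i l] by (simp add: sum_if_times)
      have "(\<lambda>m. ?z m + s * of_real (v m)) = ?z(i := ?z i + s * (- 1), l := ?z l + s * of_real \<alpha>)" for s
        using False by (auto simp: v_def)
      then show "((\<lambda>s. G j (\<lambda>i. of_real (t i) + s * of_real (v i))) has_field_derivative
          of_real (- D i + \<alpha> * D l)) (at 0)"
        using real_polyfun_directional[OF G_poly[of j] False, of ?z "- 1" "of_real \<alpha>"] by (simp add: D)
    qed (use i l in \<open>auto simp: v_def\<close>)
    then show ?thesis by (simp add: D_def)
  qed
qed

section \<open>Maximising the capacity quotient and removing one variable\<close>

lemma g_scale:
  assumes "c \<noteq> 0" "j \<le> n"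
  shows "g j (\<lambda>i. c * t i) = c ^ (n - j) * g j t"
proof -
  have "G j (\<lambda>i. of_real c * of_real (t i)) = of_real c ^ (n - j) * of_real (g j t)"
    using assms G_hom[of "of_real c" j "\<lambda>i. of_real (t i)"] G_of_real[of j t] by (metis of_real_eq_0_iff)
  also have "\<dots> = of_real (c ^ (n - j) * g j t)" by (simp only: of_real_mult of_real_power)
  finally show ?thesis by (simp only: of_real_mult[symmetric] Re_complex_of_real)
qed

text \<open>The quotient \<open>(\<Prod>i. t i) / g j t\<close> is homogeneous of degree 0, so a maximum over the simplex is a
  maximum over the whole orthant.\<close>
lemma capacity_attained:
  assumes j: "j < n"
  obtains t where "orthant j t"
    and "\<And>u. orthant j u \<Longrightarrow> (\<Prod>i\<in>{j..<n}. u i) * g j t \<le> (\<Prod>i\<in>{j..<n}. t i) * g j u"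
proof -
  define K where "K = {t. (\<forall>i. i \<notin> {j..<n} \<longrightarrow> t i = 0) \<and> (\<forall>i. 0 \<le> t i) \<and> (\<Sum>i\<in>{j..<n}. t i) = (1::real)}"
  define \<phi> where "\<phi> = (\<lambda>t. (\<Prod>i\<in>{j..<n}. t i) / g j t)"
  \<comment> \<open>One positive coordinate suffices for positivity, so the quotient is continuous
    up to the boundary of the simplex.\<close>
  have K_pos: "0 < g j t" if "t \<in> K" for t
  proof -
    have "\<exists>l\<in>{j..<n}. 0 < t l"
    proof (rule ccontr)
      assume "\<not> (\<exists>l\<in>{j..<n}. 0 < t l)"
      then have "(\<Sum>i\<in>{j..<n}. t i) \<le> 0" by (intro sum_nonpos) (simp add: not_less)
      then show False using that by (simp add: K_def)
    qed
    then obtain l where "l \<in> {j..<n}" "0 < t l" by blast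
    then have "region j (\<lambda>i. of_real (t i))"
      using that by (intro region_nonneg[where l = l]) (simp_all add: K_def)
    then show ?thesis by (rule g_pos[OF j])
  qed
  have "compact K" unfolding K_def by (rule compact_nat_simplex) simp
  moreover have orthant_K: "orthant j u \<Longrightarrow> (\<Sum>i\<in>{j..<n}. u i) = 1 \<Longrightarrow> u \<in> K" for u
    unfolding K_def orthant_def mem_Collect_eq by (metis less_imp_le order_refl)
  \<comment> \<open>The barycentre has a positive quotient. On the boundary the product vanishes, so
    the maximiser has only positive coordinates.\<close>
  define e where "e = (\<lambda>i. if i \<in> {j..<n} then 1 / real (n - j) else 0)"
  have e: "orthant j e" "e \<in> K"
  proof -
    show "orthant j e" using j by (simp add: orthant_def e_def)
    then show "e \<in> K" using j by (intro orthant_K) (simp_all add: e_def)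
  qed
  moreover have "continuous_on K \<phi>"
    unfolding \<phi>_def
  proof (intro continuous_on_divide continuous_on_prod)
    show "continuous_on K (g j)"
      using continuous_on_real_polyfun[OF G_poly] continuous_on_subset by blast
    show "\<forall>t\<in>K. g j t \<noteq> 0" using K_pos by fastforce
    show "continuous_on K (\<lambda>t. t i)" for i
      by (rule continuous_on_subset[OF continuous_on_product_coordinates]) simp
  qed
  ultimately obtain t where t: "t \<in> K" "\<And>u. u \<in> K \<Longrightarrow> \<phi> u \<le> \<phi> t"
    using continuous_attains_sup[of K \<phi>] by blast
  have "0 < \<phi> e"
    unfolding \<phi>_def using e K_pos by (intro divide_pos_pos prod_pos) (auto simp: orthant_def)
  then have "0 < \<phi> t" using t(2) e(2) by fastforce
  then have "(\<Prod>i\<in>{j..<n}. t i) \<noteq> 0" by (metis \<phi>_def div_0 less_irrefl)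
  then have t_pos: "orthant j t"
    using t(1) by (auto simp: orthant_def K_def less_le)
  moreover have "(\<Prod>i\<in>{j..<n}. u i) * g j t \<le> (\<Prod>i\<in>{j..<n}. t i) * g j u" if u: "orthant j u" for u
  proof -
    define \<sigma> where "\<sigma> = (\<Sum>i\<in>{j..<n}. u i)"
    define u' where "u' = (\<lambda>i. 1 / \<sigma> * u i)"
    have \<sigma>: "0 < \<sigma>" unfolding \<sigma>_def using u j by (intro sum_pos) (auto simp: orthant_def)
    have "u' \<in> K"
    proof (rule orthant_K)
      show "orthant j u'" using u \<sigma> by (simp add: orthant_def u'_def)
      show "(\<Sum>i\<in>{j..<n}. u' i) = 1"
        using \<sigma> unfolding u'_def sum_distrib_left[symmetric] \<sigma>_def[symmetric] by simp
    qed
    then have "\<phi> u' \<le> \<phi> t" by (rule t(2))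
    moreover have "(\<Prod>i\<in>{j..<n}. u' i) = (1 / \<sigma>) ^ (n - j) * (\<Prod>i\<in>{j..<n}. u i)"
      unfolding u'_def prod.distrib by simp
    moreover have "g j u' = (1 / \<sigma>) ^ (n - j) * g j u"
      unfolding u'_def using j \<sigma> by (intro g_scale) auto
    ultimately have "\<phi> u \<le> \<phi> t" using \<sigma> by (simp add: \<phi>_def)
    moreover have "0 < g j t" "0 < g j u"
      using K_pos[OF t(1)] g_pos[OF j region_orthant[OF u j]] by auto
    ultimately show ?thesis by (simp add: \<phi>_def divide_simps mult.commute)
  qed
  ultimately show thesis by (rule that)
qed

text \<open>With all coordinates but the \<open>i\<close>-th fixed, the product is linear in
  \<open>s\<close>. Maximality thus says that \<open>t i * g j (t(i := s)) - s * g j t\<close> has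
  its minimum at \<open>s = t i\<close>, where its derivative must vanish.\<close>

lemma critical_point:
  assumes j: "j < n" and t: "orthant j t" and i: "i \<in> {j..<n}"
    and max: "\<And>u. orthant j u \<Longrightarrow> (\<Prod>i\<in>{j..<n}. u i) * g j t \<le> (\<Prod>i\<in>{j..<n}. t i) * g j u"
  shows "t i * Re (partial_deriv i (G j) (\<lambda>i. of_real (t i))) = g j t"
proof -
  let ?d = "Re (partial_deriv i (G j) (\<lambda>i. of_real (t i)))"
  have ti: "0 < t i" using t i by (auto simp: orthant_def)
  have "((\<lambda>s. t i * g j (t(i := s)) - s * g j t) has_real_derivative t i * ?d - 1 * g j t) (at (t i))"
    by (intro DERIV_diff DERIV_cmult DERIV_cmult_right DERIV_ident real_polyfun_real_deriv[OF G_poly])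
  \<comment> \<open>The radius \<open>t i\<close> keeps \<open>s\<close> positive, so the varied
    point remains in the orthant and \<open>max\<close> applies; the common factor \<open>P\<close>
    cancels.\<close>
  moreover have "t i * g j (t(i := t i)) - t i * g j t \<le> t i * g j (t(i := s)) - s * g j t"
    if "\<bar>t i - s\<bar> < t i" for s
  proof -
    have s: "0 < s" using that by linarith
    have u: "orthant j (t(i := s))" using t i s by (auto simp: orthant_def)
    define P where "P = (\<Prod>i\<in>{j..<n} - {i}. t i)"
    have P: "0 < P" unfolding P_def using t by (intro prod_pos) (auto simp: orthant_def)
    have "(\<Prod>l\<in>{j..<n}. (t(i := s)) l) = s * P"
      unfolding P_def by (subst prod.remove[OF _ i]) (auto intro!: prod.cong)
    moreover have "(\<Prod>l\<in>{j..<n}. t l) = t i * P"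
      unfolding P_def by (subst prod.remove[OF _ i]) auto
    ultimately have "P * (s * g j t) \<le> P * (t i * g j (t(i := s)))"
      using max[OF u] by (simp only: mult.commute mult.left_commute)
    then show ?thesis using P by (simp only: mult_le_cancel_left_pos fun_upd_triv)
  qed
  ultimately have "t i * ?d - 1 * g j t = 0"
    using DERIV_local_min[OF _ ti] by blast
  then show ?thesis by simp
qed

text \<open>Applies \<open>real_rooted_deriv_bound\<close> with
  \<open>m = \<alpha>\<^sup>2 / real (n - j)\<close> to \<open>G j\<close> along the
  \<open>j\<close>-th coordinate line. Scaling by \<open>t j\<close> puts the critical point at
  \<open>s = 1\<close>, where criticality reads \<open>p'(1) = p(1)\<close>; at \<open>s = 0\<close>
  the derivative is \<open>t j\<close> times the next level.\<close>

lemma capacity_step: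
  assumes j: "Suc j < n" and t: "orthant j t"
    and crit: "\<And>i. i \<in> {j..<n} \<Longrightarrow> t i * Re (partial_deriv i (G j) (\<lambda>i. of_real (t i))) = g j t"
  shows "t j * g (Suc j) (t(j := 0)) \<le> exp (\<alpha>\<^sup>2 / real (n - j) - 1) * g j t"
proof -
  let ?z = "\<lambda>i. complex_of_real (t i)"
  let ?k = "real (n - j)"
  have jn: "j < n" using j by simp
  have tj: "0 < t j" using t jn by (auto simp: orthant_def)
  have k: "0 < ?k" using jn by simp
  have reg: "region j ?z" by (rule region_orthant[OF t jn])
  have pos: "0 < g j t" by (rule g_pos[OF jn reg])
  obtain p where p0: "\<And>s. G j (\<lambda>i. ?z i * (if i = j then 0 else 1) + s * (if i = j then ?z j else 0)) = poly p s"
    using real_polyfun_line[OF G_poly[of j], of "\<lambda>i. ?z i * (if i = j then 0 else 1)" "\<lambda>i. if i = j then ?z j else 0"]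
    by blast
  have "(\<lambda>i. ?z i * (if i = j then 0 else 1) + s * (if i = j then ?z j else 0)) = ?z(j := s * ?z j)" for s
    by auto
  with p0 have p: "G j (?z(j := s * ?z j)) = poly p s" for s by simp
  have sum_upd: "(\<Sum>i<n. Re ((?z(j := s * ?z j)) i) * w i x) =
      Re s * t j * w j x + (\<Sum>i\<in>{..<n} - {j}. t i * w i x)" for s x
    using sum_fun_upd[of "{..<n}" j "\<lambda>i u. Re u * w i x" ?z "s * ?z j"] jn by simp
  have t0: "t i = 0" if "i \<notin> {j..<n}" for i using t that by (simp add: orthant_def)
  have t_nn: "0 \<le> t i" for i
    using t by (cases "i \<in> {j..<n}") (auto simp: orthant_def less_imp_le)
  \<comment> \<open>Common criterion for the two half-planes: only \<open>Re s\<close> enters the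
    form, and it must stay positive.\<close>
  have nz: "poly p s \<noteq> 0"
    if "\<And>x. x \<in> X \<Longrightarrow> 0 < Re s * t j * w j x + (\<Sum>i\<in>{..<n} - {j}. t i * w i x)" for s
  proof -
    have "region j (?z(j := s * ?z j))"
      unfolding region_def sum_upd using that t0 jn by auto
    then show ?thesis unfolding p[symmetric] by (rule G_nonzero[OF jn])
  qed
  have d1: "(poly p has_field_derivative ?z j * partial_deriv j (G j) ?z) (at 1)"
  proof -
    have "((\<lambda>s. G j (?z(j := s * ?z j))) has_field_derivative partial_deriv j (G j) ?z * ?z j) (at 1)"
    proof (rule DERIV_chain2[where f = "\<lambda>s. G j (?z(j := s))" and g = "\<lambda>s. s * ?z j"])
      show "((\<lambda>s. G j (?z(j := s))) has_field_derivative partial_deriv j (G j) ?z) (at (1 * ?z j))"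
        using real_polyfun_partial_deriv(2)[OF G_poly[of j], of ?z j] by simp
      show "((\<lambda>s. s * ?z j) has_field_derivative ?z j) (at 1)"
        using DERIV_cmult_right[OF DERIV_ident, of "?z j" 1 UNIV] by simp
    qed
    then show ?thesis unfolding p by (simp only: mult.commute)
  qed
  have d0: "(poly p has_field_derivative ?z j * G (Suc j) (?z(j := 0))) (at 0)"
  proof -
    have "((\<lambda>s. G j (?z(j := s * ?z j))) has_field_derivative G (Suc j) (?z(j := 0)) * ?z j) (at 0)"
    proof (rule DERIV_chain2[where f = "\<lambda>s. G j (?z(j := s))" and g = "\<lambda>s. s * ?z j"])
      show "((\<lambda>s. G j (?z(j := s))) has_field_derivative G (Suc j) (?z(j := 0))) (at (0 * ?z j))"
        using G_Suc_deriv[of j "?z(j := 0)"] by simp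
      show "((\<lambda>s. s * ?z j) has_field_derivative ?z j) (at 0)"
        using DERIV_cmult_right[OF DERIV_ident, of "?z j" 0 UNIV] by simp
    qed
    then show ?thesis unfolding p by (simp only: mult.commute)
  qed
  have p1: "poly p 1 = of_real (g j t)"
  proof -
    have "?z(j := 1 * ?z j) = ?z" by auto
    then have "poly p 1 = G j ?z" using p[of 1] by metis
    also have "\<dots> = of_real (g j t)" by (rule G_of_real)
    finally show ?thesis .
  qed
  have D: "partial_deriv j (G j) ?z = of_real (Re (partial_deriv j (G j) ?z))"
    by (rule real_polyfun_of_real[OF real_polyfun_partial_deriv(1)[OF G_poly]])
  have "Re (poly (pderiv p) 0) \<le> exp (\<alpha>\<^sup>2 / ?k - 1) * g j t"
  proof (rule real_rooted_deriv_bound)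
    show "poly p s \<noteq> 0" if "Im s \<noteq> 0" for s
    proof -
      txt \<open>Multiplication by \<open>- \<i> Im s\<close> makes all coordinates but the \<open>j\<close>-th purely imaginary and moves the
        \<open>j\<close>-th one into the right half-plane.\<close>
      let ?c = "- \<i> * of_real (Im s)"
      have c: "?c \<noteq> 0" using that by simp
      have "region j (\<lambda>i. ?c * (?z(j := s * ?z j)) i)"
        unfolding region_def
      proof (intro conjI ballI allI impI)
        fix x assume x: "x \<in> X"
        have "(\<Sum>i<n. Re (?c * (?z(j := s * ?z j)) i) * w i x) = (Im s)\<^sup>2 * t j * w j x"
          using sum_fun_upd[of "{..<n}" j "\<lambda>i u. Re (?c * u) * w i x" ?z "s * ?z j"] jn
          by (simp add: power2_eq_square)
        also have "\<dots> > 0" using w_pos[OF jn x] tj that by simp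
        finally show "0 < (\<Sum>i<n. Re (?c * (?z(j := s * ?z j)) i) * w i x)" .
      qed (use t0 jn in auto)
      then have "G j (\<lambda>i. ?c * (?z(j := s * ?z j)) i) \<noteq> 0" by (rule G_nonzero[OF jn])
      then show ?thesis
        unfolding G_hom[OF c less_imp_le[OF jn]] p by simp
    qed
    show "poly p s \<noteq> 0" if "0 \<le> Re s" for s
    proof (rule nz)
      fix x assume x: "x \<in> X"
      have "0 \<le> Re s * t j * w j x" using that tj w_pos[OF jn x] by simp
      moreover have "0 < (\<Sum>i\<in>{..<n} - {j}. t i * w i x)"
      proof (rule sum_pos2)
        \<comment> \<open>A variable other than the \<open>j\<close>-th remains, so the form is
          positive even when \<open>Re s = 0\<close>.\<close>
        show "Suc j \<in> {..<n} - {j}" "finite ({..<n} - {j})" using j by auto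
        show "0 < t (Suc j) * w (Suc j) x" using t j w_pos[OF j x] by (auto simp: orthant_def)
        show "0 \<le> t i * w i x" if "i \<in> {..<n} - {j}" for i
          using t_nn[of i] w_pos[OF _ x, of i] that by simp
      qed
      ultimately show "0 < Re s * t j * w j x + (\<Sum>i\<in>{..<n} - {j}. t i * w i x)" by simp
    qed
    \<comment> \<open>Criticality makes \<open>t i\<close> inversely proportional to the
      \<open>i\<close>-th partial derivative, so \<open>partial_le\<close> gives
      \<open>t j \<le> \<alpha> * t i\<close>. A second factor \<open>\<alpha>\<close> comes from
      comparing the forms. Summing over the \<open>n - j\<close> remaining variables shows that the
      \<open>j\<close>-th term is at most the fraction
      \<open>\<alpha>\<^sup>2 / real (n - j)\<close> of the total form, which tolerates lowering
      \<open>s\<close> from 1 to just above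
      \<open>1 - real (n - j) / \<alpha>\<^sup>2\<close>.\<close>
    show "poly p s \<noteq> 0" if "1 - 1 / (\<alpha>\<^sup>2 / ?k) < Re s" for s
    proof (rule nz)
      fix x assume x: "x \<in> X"
      have le: "t j \<le> \<alpha> * t i" if i: "i \<in> {j..<n}" for i
      proof -
        define di where "di = Re (partial_deriv i (G j) ?z)"
        define dj where "dj = Re (partial_deriv j (G j) ?z)"
        have ti: "0 < t i" using t i by (auto simp: orthant_def)
        have "t i * di = g j t" "t j * dj = g j t" using crit[OF i] crit[of j] jn by (auto simp: di_def dj_def)
        moreover have "di \<le> \<alpha> * dj"
          unfolding di_def dj_def using partial_le[OF jn reg i, of j] jn by simp
        moreover have "di = g j t / t i" "dj = g j t / t j"
          using calculation(1,2) ti tj by (auto simp: nonzero_eq_divide_eq mult.commute)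
        ultimately have "g j t / t i \<le> \<alpha> * (g j t / t j)" by simp
        then have "g j t * t j \<le> g j t * (\<alpha> * t i)" using ti tj by (simp add: field_simps)
        then show ?thesis using pos by simp
      qed
      have le2: "t j * w j x \<le> \<alpha>\<^sup>2 * (t i * w i x)" if i: "i \<in> {j..<n}" for i
      proof -
        have "t j * w j x \<le> (\<alpha> * t i) * (\<alpha> * w i x)"
          using le[OF i] w_le[OF jn _ x, of i] w_pos[OF jn x] i alpha t_nn[of i] by (intro mult_mono) auto
        then show ?thesis by (simp add: power2_eq_square algebra_simps)
      qed
      have "?k * (t j * w j x) = (\<Sum>i\<in>{j..<n}. t j * w j x)" by simp
      also have "\<dots> \<le> (\<Sum>i\<in>{j..<n}. \<alpha>\<^sup>2 * (t i * w i x))" by (intro sum_mono le2)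
      also have "\<dots> = \<alpha>\<^sup>2 * (\<Sum>i\<in>{j..<n}. t i * w i x)" by (simp add: sum_distrib_left)
      also have "(\<Sum>i\<in>{j..<n}. t i * w i x) = (\<Sum>i<n. t i * w i x)"
        using t0 by (intro sum.mono_neutral_left) auto
      also have "\<dots> = t j * w j x + (\<Sum>i\<in>{..<n} - {j}. t i * w i x)"
        using jn by (intro sum.remove) auto
      finally have "?k / \<alpha>\<^sup>2 * (t j * w j x) \<le> t j * w j x + (\<Sum>i\<in>{..<n} - {j}. t i * w i x)"
        using alpha by (simp add: field_simps)
      moreover have "(1 - Re s) * (t j * w j x) < ?k / \<alpha>\<^sup>2 * (t j * w j x)"
        using that tj w_pos[OF jn x] by (intro mult_strict_right_mono) auto
      ultimately show "0 < Re s * t j * w j x + (\<Sum>i\<in>{..<n} - {j}. t i * w i x)"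
        by (simp add: algebra_simps)
    qed
    show "0 < \<alpha>\<^sup>2 / ?k" using alpha k by simp
    show "poly p 1 = of_real (g j t)" by (rule p1)
    show "0 < g j t" by (rule pos)
    have "poly (pderiv p) 1 = ?z j * partial_deriv j (G j) ?z" by (rule DERIV_unique[OF poly_DERIV d1])
    also have "\<dots> = of_real (t j * Re (partial_deriv j (G j) ?z))" by (subst D) simp
    also have "\<dots> = poly p 1" unfolding p1 using crit[of j] jn by simp
    finally show "poly (pderiv p) 1 = poly p 1" .
  qed
  moreover have "Re (poly (pderiv p) 0) = t j * g (Suc j) (t(j := 0))"
  proof -
    have "?z(j := 0) = (\<lambda>i. of_real ((t(j := 0)) i))" by auto
    moreover have "poly (pderiv p) 0 = ?z j * G (Suc j) (?z(j := 0))"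
      by (rule DERIV_unique[OF poly_DERIV d0])
    ultimately show ?thesis by (simp del: iter_partial.simps)
  qed
  ultimately show ?thesis by simp
qed

text \<open>A witness for an upper bound on the infimum of \<open>g j t\<close> over the product of
  coordinates. Each level contributes the factor
  \<open>exp (\<alpha>\<^sup>2 / real (n - i) - 1)\<close>; the all-ones point starts with value
  1.\<close>

lemma capacity_bound:
  assumes "j < n"
  shows "\<exists>t. orthant j t \<and> g j t \<le> exp (\<alpha>\<^sup>2 * (\<Sum>i<j. 1 / real (n - i)) - real j) * (\<Prod>i\<in>{j..<n}. t i)"
  using assms
proof (induction j)
  case 0
  let ?e = "\<lambda>i. if i < n then 1 else (0::real)"
  have "G 0 (\<lambda>i. of_real (?e i)) = 1" using F_one by (simp add: if_distrib cong: if_cong)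
  then show ?case by (intro exI[of _ ?e]) (simp add: orthant_def)
next
  case (Suc j)
  let ?B = "exp (\<alpha>\<^sup>2 * (\<Sum>i<j. 1 / real (n - i)) - real j)"
  have jn: "j < n" using Suc.prems by simp
  obtain u where u: "orthant j u" "g j u \<le> ?B * (\<Prod>i\<in>{j..<n}. u i)" using Suc.IH jn by blast
  obtain t where t: "orthant j t"
    and max: "\<And>u. orthant j u \<Longrightarrow> (\<Prod>i\<in>{j..<n}. u i) * g j t \<le> (\<Prod>i\<in>{j..<n}. t i) * g j u"
    using capacity_attained[OF jn] by blast
  have tj: "0 < t j" using t jn by (auto simp: orthant_def)
  have pos: "0 < (\<Prod>i\<in>{j..<n}. u i)" "0 < (\<Prod>i\<in>{j..<n}. t i)"
    using u(1) t by (auto simp: orthant_def intro!: prod_pos)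
  \<comment> \<open>The witness \<open>u\<close> need not be critical; maximality transfers its
    bound to the critical point \<open>t\<close>.\<close>
  have "(\<Prod>i\<in>{j..<n}. u i) * g j t \<le> (\<Prod>i\<in>{j..<n}. t i) * (?B * (\<Prod>i\<in>{j..<n}. u i))"
    using max[OF u(1)] u(2) pos(2) by (meson mult_left_mono less_imp_le order_trans)
  then have "(\<Prod>i\<in>{j..<n}. u i) * g j t \<le> (\<Prod>i\<in>{j..<n}. u i) * (?B * (\<Prod>i\<in>{j..<n}. t i))"
    by (simp only: mult.commute mult.left_commute)
  then have "g j t \<le> ?B * (\<Prod>i\<in>{j..<n}. t i)"
    using pos(1) by (simp only: mult_le_cancel_left_pos)
  also have "(\<Prod>i\<in>{j..<n}. t i) = t j * (\<Prod>i\<in>{Suc j..<n}. t i)"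
    using jn by (simp add: prod.atLeast_Suc_lessThan)
  finally have gt: "g j t \<le> ?B * (t j * (\<Prod>i\<in>{Suc j..<n}. t i))" .
  have "t j * g (Suc j) (t(j := 0)) \<le> exp (\<alpha>\<^sup>2 / real (n - j) - 1) * g j t"
    using Suc.prems t critical_point[OF jn t _ max] by (rule capacity_step)
  also have "\<dots> \<le> exp (\<alpha>\<^sup>2 / real (n - j) - 1) * (?B * (t j * (\<Prod>i\<in>{Suc j..<n}. t i)))"
    using gt by (intro mult_left_mono) auto
  also have "\<dots> = t j * (exp (\<alpha>\<^sup>2 * (\<Sum>i<Suc j. 1 / real (n - i)) - real (Suc j)) * (\<Prod>i\<in>{Suc j..<n}. t i))"
    by (simp add: algebra_simps exp_add[symmetric] add_divide_distrib exp_diff exp_minus field_simps)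
  finally have "g (Suc j) (t(j := 0)) \<le>
      exp (\<alpha>\<^sup>2 * (\<Sum>i<Suc j. 1 / real (n - i)) - real (Suc j)) * (\<Prod>i\<in>{Suc j..<n}. t i)"
    using tj by (simp only: mult_le_cancel_left_pos)
  also have "(\<Prod>i\<in>{Suc j..<n}. t i) = (\<Prod>i\<in>{Suc j..<n}. (t(j := 0)) i)"
    by (intro prod.cong) auto
  finally have "g (Suc j) (t(j := 0)) \<le>
      exp (\<alpha>\<^sup>2 * (\<Sum>i<Suc j. 1 / real (n - i)) - real (Suc j)) * (\<Prod>i\<in>{Suc j..<n}. (t(j := 0)) i)" .
  moreover have "orthant (Suc j) (t(j := 0))"
    using t by (auto simp: orthant_def Suc_le_eq)
  ultimately show ?case by blast
qed

text \<open>With one variable left, \<open>G (n - 1)\<close> is linear in it, so its derivative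
  equals \<open>g (n - 1) t / t (n - 1)\<close>. The last differentiation costs no factor, whence
  only \<open>n - 1\<close> steps are counted.\<close>

lemma coefficient_bound:
  assumes n: "0 < n"
  shows "g n (\<lambda>_. 0) \<le> exp (\<alpha>\<^sup>2 * (\<Sum>i<n - 1. 1 / real (n - i)) - (real n - 1))"
proof -
  define j where "j = n - 1"
  have nj: "n = Suc j" using n by (simp add: j_def)
  have jn: "j < n" and single: "{j..<n} = {j}" using nj by auto
  let ?E = "exp (\<alpha>\<^sup>2 * (\<Sum>i<j. 1 / real (n - i)) - real j)"
  obtain t where t: "orthant j t" "g j t \<le> ?E * (\<Prod>i\<in>{j..<n}. t i)"
    using capacity_bound[OF jn] by blast
  let ?c = "G j (\<lambda>i. of_real (t i))"
  have tj: "0 < t j" and t0: "\<And>i. i \<noteq> j \<Longrightarrow> t i = 0"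
    using t(1) unfolding orthant_def single by auto
  have "G j ((\<lambda>_. 0)(j := s)) = s * (?c / of_real (t j))" for s
  proof (cases "s = 0")
    case True
    moreover have "(\<lambda>_. 0)(j := 0) = (\<lambda>_. 0::complex)" by auto
    ultimately show ?thesis using G_zero[OF jn] by (simp only: mult_zero_left)
  next
    case False
    have eq: "(\<lambda>_. 0)(j := s) = (\<lambda>i. s / of_real (t j) * of_real (t i))"
      using tj t0 by (auto simp: fun_eq_iff)
    have "G j ((\<lambda>_. 0)(j := s)) = (s / of_real (t j)) ^ (n - j) * ?c"
      unfolding eq using False tj jn by (intro G_hom) auto
    then show ?thesis by (simp add: nj)
  qed
  then have "((\<lambda>s. s * (?c / of_real (t j))) has_field_derivative G n (\<lambda>_. 0)) (at 0)"
    using G_Suc_deriv[of j "\<lambda>_. 0"] by (simp only: nj)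
  moreover have "((\<lambda>s. s * (?c / of_real (t j))) has_field_derivative 1 * (?c / of_real (t j))) (at 0)"
    by (intro DERIV_cmult_right DERIV_ident)
  ultimately have "G n (\<lambda>_. 0) = 1 * (?c / of_real (t j))" by (rule DERIV_unique)
  then have "g n (\<lambda>_. 0) = g j t / t j" by (simp only: mult_1 Re_divide_of_real of_real_0)
  also have "\<dots> \<le> ?E" using t(2) tj by (simp add: single divide_simps)
  also have "real j = real n - 1" using nj by simp
  finally show ?thesis by (simp add: j_def)
qed

end

section \<open>Determinants of pencils of symmetric matrices\<close>

lemma inner_matrix_vector_sum:
  fixes A :: "real^'n^'n"
  shows "x \<bullet> (A *v y) = (\<Sum>i\<in>UNIV. \<Sum>j\<in>UNIV. x $ i * A $ i $ j * y $ j)"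
  by (simp add: inner_vec_def matrix_vector_mult_def sum_distrib_left mult.assoc)

lemma symmetric_mat_inner:
  assumes "symmetric_mat A"
  shows "x \<bullet> (A *v y) = (A *v x) \<bullet> y"
  using assms dot_lmul_matrix[of x A y] by (simp add: symmetric_mat_def flip: transpose_matrix_vector)

text \<open>The quadratic form attains its maximum \<open>m\<close> on the unit sphere at some
  \<open>v\<close>. Then \<open>m * (x \<bullet> x) - x \<bullet> (A *v x)\<close> is nonnegative
  and vanishes at \<open>v\<close>, so moving from \<open>v\<close> against the residual
  \<open>r\<close> would make it negative to first order unless \<open>r = 0\<close>.\<close>

lemma rayleigh_eigenvalue:
  fixes A :: "real^'n^'n"
  assumes A: "symmetric_mat A"
  obtains m where "m \<in> eigenvalues A" "\<And>x. x \<bullet> (A *v x) \<le> m * (x \<bullet> x)"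
proof -
  have "continuous_on (sphere 0 1) (\<lambda>x. x \<bullet> (A *v x))"
    by (intro continuous_on_inner continuous_on_id linear_continuous_on
        matrix_vector_mul_bounded_linear)
  moreover have "sphere (0::real^'n) 1 \<noteq> {}" by simp
  ultimately obtain v where v: "norm v = 1" "\<And>x. norm x = 1 \<Longrightarrow> x \<bullet> (A *v x) \<le> v \<bullet> (A *v v)"
    using continuous_attains_sup[OF compact_sphere, of "0::real^'n" 1 "\<lambda>x. x \<bullet> (A *v x)"] by auto
  define m where "m = v \<bullet> (A *v v)"
  have bound: "x \<bullet> (A *v x) \<le> m * (x \<bullet> x)" for x
  proof (cases "x = 0")
    case False
    define u where "u = (1 / norm x) *\<^sub>R x"
    have x: "x = norm x *\<^sub>R u" using False by (simp add: u_def)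
    have "u \<bullet> (A *v u) \<le> m" using v(2)[of u] False by (simp add: u_def m_def)
    then have "(norm x)\<^sup>2 * (u \<bullet> (A *v u)) \<le> (norm x)\<^sup>2 * m" by (intro mult_left_mono) auto
    moreover have "x \<bullet> (A *v x) = (norm x)\<^sup>2 * (u \<bullet> (A *v u))"
      by (subst (1 2) x) (simp add: matrix_vector_mult_scaleR power2_eq_square)
    ultimately show ?thesis by (simp add: power2_norm_eq_inner mult.commute)
  qed simp
  define r where "r = m *\<^sub>R v - A *v v"
  define f where "f = m * (r \<bullet> r) - r \<bullet> (A *v r)"
  have f: "0 \<le> f" using bound[of r] by (simp add: f_def)
  have quad: "2 * s * (r \<bullet> r) \<le> s\<^sup>2 * f" for s
  proof -
    have "0 \<le> m * ((v - s *\<^sub>R r) \<bullet> (v - s *\<^sub>R r)) - (v - s *\<^sub>R r) \<bullet> (A *v (v - s *\<^sub>R r))"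
      using bound by simp
    also have "\<dots> = (m * (v \<bullet> v) - v \<bullet> (A *v v)) - 2 * s * (r \<bullet> (m *\<^sub>R v - A *v v)) + s\<^sup>2 * f"
      using symmetric_mat_inner[OF A, of v r] inner_commute[of "A *v v" r] inner_commute[of v r]
      by (simp add: f_def matrix_vector_mult_diff_distrib matrix_vector_mult_scaleR inner_diff_left
          inner_diff_right algebra_simps power2_eq_square)
    also have "m * (v \<bullet> v) - v \<bullet> (A *v v) = 0"
      using v(1) by (simp add: m_def flip: power2_norm_eq_inner)
    finally show ?thesis by (simp add: r_def)
  qed
  have "r \<bullet> r = 0"
  proof (rule ccontr)
    assume "r \<bullet> r \<noteq> 0"
    then have R: "0 < r \<bullet> r" using inner_ge_zero[of r] by linarith
    \<comment> \<open>Small enough for the first-order term to dominate; the \<open>+ 1\<close>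
      avoids division by 0.\<close>
    define s where "s = (r \<bullet> r) / (f + 1)"
    have s: "0 < s" "s * f \<le> r \<bullet> r" using R f by (auto simp: s_def field_simps)
    have "s * (2 * (r \<bullet> r)) \<le> s * (s * f)" using quad[of s] by (simp add: power2_eq_square algebra_simps)
    then have "2 * (r \<bullet> r) \<le> s * f" using s(1) by simp
    then show False using s(2) R by simp
  qed
  then have "A *v v = m *\<^sub>R v" by (simp add: r_def)
  moreover have "v \<noteq> 0" using v(1) by auto
  ultimately have "m \<in> eigenvalues A" by (auto simp: eigenvalues_def)
  then show thesis using bound that by blast
qed

text \<open>Eigenvectors for distinct eigenvalues are orthogonal, hence independent. Finiteness
  gives \<open>Max\<close> and \<open>Min\<close> their order properties.\<close>

lemma finite_eigenvalues:
  fixes A :: "real^'n^'n"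
  assumes A: "symmetric_mat A"
  shows "finite (eigenvalues A)"
proof -
  obtain v where v: "\<And>l. l \<in> eigenvalues A \<Longrightarrow> v l \<noteq> 0 \<and> A *v v l = l *\<^sub>R v l"
  proof -
    have "\<forall>l\<in>eigenvalues A. \<exists>v. v \<noteq> 0 \<and> A *v v = l *\<^sub>R v" by (simp add: eigenvalues_def)
    from bchoice[OF this] show thesis using that by blast
  qed
  have orth: "v l \<bullet> v m = 0" if lm: "l \<in> eigenvalues A" "m \<in> eigenvalues A" "l \<noteq> m" for l m
  proof -
    have "l * (v l \<bullet> v m) = m * (v l \<bullet> v m)"
      using symmetric_mat_inner[OF A, of "v l" "v m"] v lm by simp
    then show ?thesis using lm(3) by simp
  qed
  have "inj_on v (eigenvalues A)"
    using orth v by (metis inj_onI inner_eq_zero_iff)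
  moreover have "independent (v ` eigenvalues A)"
    using orth v by (intro pairwise_orthogonal_independent) (auto simp: pairwise_def orthogonal_def)
  ultimately show ?thesis using finiteI_independent finite_imageD by blast
qed

lemma inner_le_lambda_max:
  assumes "symmetric_mat A"
  shows "x \<bullet> (A *v x) \<le> lambda_max A * (x \<bullet> x)"
proof -
  obtain m where m: "m \<in> eigenvalues A" "x \<bullet> (A *v x) \<le> m * (x \<bullet> x)"
    using rayleigh_eigenvalue[OF assms] by blast
  have "m \<le> lambda_max A"
    unfolding lambda_max_def using finite_eigenvalues[OF assms] m(1) by (rule Max_ge)
  then show ?thesis using m(2) by (meson inner_ge_zero mult_right_mono order_trans)
qed

lemma lambda_min_le_inner:
  assumes A: "symmetric_mat A"
  shows "lambda_min A * (x \<bullet> x) \<le> x \<bullet> (A *v x)"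
proof -
  have neg: "(- A) *v y = - (A *v y)" for y
    by (simp add: matrix_vector_mult_def vec_eq_iff sum_negf)
  \<comment> \<open>The lower bound is the upper Rayleigh bound for \<open>- A\<close>, whose
    eigenvalues are the negated ones.\<close>
  have "symmetric_mat (- A)"
    using A by (simp add: symmetric_mat_def transpose_def vec_eq_iff)
  then obtain m where m: "m \<in> eigenvalues (- A)" "x \<bullet> ((- A) *v x) \<le> m * (x \<bullet> x)"
    using rayleigh_eigenvalue by blast
  have "- m \<in> eigenvalues A"
    using m(1) unfolding eigenvalues_def neg mem_Collect_eq by (metis minus_minus scaleR_minus_left)
  then have "lambda_min A \<le> - m"
    unfolding lambda_min_def using finite_eigenvalues[OF A] by (intro Min_le)
  then have "lambda_min A * (x \<bullet> x) \<le> - m * (x \<bullet> x)" by (intro mult_right_mono) auto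
  then show ?thesis using m(2) by (simp add: neg)
qed

section \<open>Stability of the determinant polynomial\<close>

definition det_pencil :: "(nat \<Rightarrow> real^'n^'n) \<Rightarrow> (nat \<Rightarrow> complex) \<Rightarrow> complex" where
  "det_pencil Q z = det ((\<chi> i j. \<Sum>k<CARD('n). z k * of_real (Q k $ i $ j)) :: complex^'n^'n)"

lemma real_polyfun_det_pencil: "real_polyfun (det_pencil Q)"
proof -
  have sign: "real_polyfun (\<lambda>z. of_int (sign p))" for p :: "'b \<Rightarrow> 'b"
    using real_polyfun.const[of "of_int (sign p)"] by simp
  have "real_polyfun (\<lambda>z. det_pencil Q z)"
    unfolding det_pencil_def det_def
    by (intro real_polyfun_sum real_polyfun.mult real_polyfun_prod sign)
      (simp, intro real_polyfun_sum real_polyfun.mult real_polyfun.var real_polyfun.const)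
  then show ?thesis by simp
qed

lemma det_pencil_scale:
  fixes Q :: "nat \<Rightarrow> real^'n^'n"
  shows "det_pencil Q (\<lambda>i. c * z i) = c ^ CARD('n) * det_pencil Q z"
proof -
  have "(\<Sum>k<CARD('n). c * z k * of_real (Q k $ i $ j)) = c * (\<Sum>k<CARD('n). z k * of_real (Q k $ i $ j))"
    for i j by (simp add: sum_distrib_left mult.assoc)
  then have "det_pencil Q (\<lambda>i. c * z i) =
      det ((\<chi> i j. c * (\<Sum>k<CARD('n). z k * of_real (Q k $ i $ j))) :: complex^'n^'n)"
    by (simp only: det_pencil_def)
  also have "\<dots> = c ^ CARD('n) * det_pencil Q z"
    unfolding det_pencil_def det_def sum_distrib_left[of "c ^ CARD('n)"]
    by (simp add: prod.distrib mult.left_commute)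
  finally show ?thesis .
qed

lemma det_pencil_of_real:
  fixes Q :: "nat \<Rightarrow> real^'n^'n"
  shows "det_pencil Q (\<lambda>i. of_real (t i)) = of_real (det (\<Sum>i<CARD('n). t i *\<^sub>R Q i))"
  by (simp add: det_pencil_def det_def sum_component)

text \<open>The cross terms between real and imaginary parts cancel by symmetry, so the Hermitian
  form is real.\<close>

lemma complex_quadratic_form:
  fixes A :: "real^'n^'n" and v :: "complex^'n"
  assumes "symmetric_mat A"
  defines "x \<equiv> \<chi> i. Re (v $ i)" and "y \<equiv> \<chi> i. Im (v $ i)"
  shows "(\<Sum>i\<in>UNIV. \<Sum>j\<in>UNIV. cnj (v $ i) * of_real (A $ i $ j) * v $ j) =
    of_real (x \<bullet> (A *v x) + y \<bullet> (A *v y))"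
proof (rule complex_eqI)
  have "x \<bullet> (A *v y) - y \<bullet> (A *v x) = 0"
    using symmetric_mat_inner[OF assms(1), of x y] by (simp add: inner_commute)
  then show "Im (\<Sum>i\<in>UNIV. \<Sum>j\<in>UNIV. cnj (v $ i) * of_real (A $ i $ j) * v $ j) =
      Im (of_real (x \<bullet> (A *v x) + y \<bullet> (A *v y)))"
    unfolding inner_matrix_vector_sum by (simp add: x_def y_def sum_subtractf algebra_simps)
  show "Re (\<Sum>i\<in>UNIV. \<Sum>j\<in>UNIV. cnj (v $ i) * of_real (A $ i $ j) * v $ j) =
      Re (of_real (x \<bullet> (A *v x) + y \<bullet> (A *v y)))"
    unfolding inner_matrix_vector_sum by (simp add: x_def y_def sum.distrib algebra_simps)
qed

text \<open>A kernel vector \<open>v\<close> of a singular pencil makes its Hermitian form vanish.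
  The real part of that form is the positive form at \<open>Re v\<close> plus that at
  \<open>Im v\<close>, and at least one of these vectors is nonzero.\<close>

lemma det_pencil_nonzero:
  fixes Q :: "nat \<Rightarrow> real^'n^'n"
  assumes sym: "\<And>k. k < CARD('n) \<Longrightarrow> symmetric_mat (Q k)"
    and pos: "\<And>x. x \<noteq> 0 \<Longrightarrow> 0 < (\<Sum>k<CARD('n). Re (z k) * (x \<bullet> (Q k *v x)))"
  shows "det_pencil Q z \<noteq> 0"
proof
  let ?M = "(\<chi> i j. \<Sum>k<CARD('n). z k * of_real (Q k $ i $ j)) :: complex^'n^'n"
  assume "det_pencil Q z = 0"
  then have "\<not> invertible ?M" by (simp add: det_pencil_def invertible_det_nz)
  then obtain v where v: "v \<noteq> 0" "?M *v v = 0"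
    using matrix_left_invertible_ker[of ?M] by (auto simp: invertible_left_inverse)
  define x where "x = (\<chi> i. Re (v $ i))"
  define y where "y = (\<chi> i. Im (v $ i))"
  have "0 = (\<Sum>i\<in>UNIV. cnj (v $ i) * (?M *v v) $ i)" by (simp add: v(2))
  also have "\<dots> = (\<Sum>i\<in>UNIV. \<Sum>j\<in>UNIV. \<Sum>k<CARD('n). z k * (cnj (v $ i) * of_real (Q k $ i $ j) * v $ j))"
    by (simp add: matrix_vector_mult_def sum_distrib_left sum_distrib_right algebra_simps)
  also have "\<dots> = (\<Sum>i\<in>UNIV. \<Sum>k<CARD('n). \<Sum>j\<in>UNIV. z k * (cnj (v $ i) * of_real (Q k $ i $ j) * v $ j))"
    by (intro sum.cong refl sum.swap)
  also have "\<dots> = (\<Sum>k<CARD('n). \<Sum>i\<in>UNIV. \<Sum>j\<in>UNIV. z k * (cnj (v $ i) * of_real (Q k $ i $ j) * v $ j))"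
    by (rule sum.swap)
  also have "\<dots> = (\<Sum>k<CARD('n). z k * of_real (x \<bullet> (Q k *v x) + y \<bullet> (Q k *v y)))"
    unfolding sum_distrib_left[symmetric] x_def y_def
    by (intro sum.cong refl arg_cong2[where f = "(*)"] complex_quadratic_form sym) simp
  finally have "0 = Re (\<Sum>k<CARD('n). z k * of_real (x \<bullet> (Q k *v x) + y \<bullet> (Q k *v y)))" by simp
  also have "\<dots> = (\<Sum>k<CARD('n). Re (z k) * (x \<bullet> (Q k *v x))) + (\<Sum>k<CARD('n). Re (z k) * (y \<bullet> (Q k *v y)))"
    by (simp add: sum.distrib algebra_simps)
  finally have zero: "0 = (\<Sum>k<CARD('n). Re (z k) * (x \<bullet> (Q k *v x))) + (\<Sum>k<CARD('n). Re (z k) * (y \<bullet> (Q k *v y)))" .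
  have nonneg: "0 \<le> (\<Sum>k<CARD('n). Re (z k) * (u \<bullet> (Q k *v u)))" for u
    using pos[of u] by (cases "u = 0") auto
  consider "x \<noteq> 0" | "y \<noteq> 0"
    using v(1) by (auto simp: x_def y_def vec_eq_iff complex_eq_iff)
  then show False
  proof cases
    case 1
    then show False using zero pos[of x] nonneg[of y] by linarith
  next
    case 2
    then show False using zero pos[of y] nonneg[of x] by linarith
  qed
qed

section \<open>Harmonic sums and the final estimate\<close>

text \<open>Telescopes \<open>1 / (m + 2) \<le> ln (m + 2) - ln (m + 1)\<close>. The sum starts at
  1/2 because the last differentiation contributes nothing.\<close>

lemma sum_inverse_le_ln: "(\<Sum>i<m. 1 / (real i + 2)) \<le> ln (real m + 1)"
proof (induction m)
  case (Suc m)
  have "ln ((real m + 1) / (real m + 2)) \<le> (real m + 1) / (real m + 2) - 1"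
    by (intro ln_le_minus_one) auto
  also have "\<dots> = - (1 / (real m + 2))" by (simp add: field_simps)
  finally have "1 / (real m + 2) \<le> ln (real m + 2) - ln (real m + 1)" by (simp add: ln_div)
  then show ?case using Suc by (simp add: add.commute)
qed simp

lemma sum_inverse_reverse_le_ln:
  assumes "0 < n"
  shows "(\<Sum>i<n - 1. 1 / real (n - i)) \<le> ln (real n)"
proof -
  have "(\<Sum>i<n - 1. 1 / real (n - i)) = (\<Sum>i<n - 1. 1 / (real (n - 1 - Suc i) + 2))"
    by (intro sum.cong refl) (auto simp: of_nat_diff)
  also have "\<dots> = (\<Sum>i<n - 1. 1 / (real i + 2))"
    by (rule sum.nat_diff_reindex)
  also have "\<dots> \<le> ln (real (n - 1) + 1)" by (rule sum_inverse_le_ln)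
  also have "real (n - 1) + 1 = real n" using assms by simp
  finally show ?thesis .
qed

theorem theorem1p4:
  fixes Q :: "nat \<Rightarrow> real^'n^'n" and \<alpha> :: real
  assumes "\<alpha> \<ge> 1"
    and "\<forall>i<CARD('n). pos_def (Q i)"
    and "doubly_stochastic Q"
    and "alpha_conditioned \<alpha> Q"
  shows "mixed_discr Q \<le> real CARD('n) powr (\<alpha> ^ 4) * exp (- (real CARD('n) - 1))"
proof -
  let ?n = "CARD('n)"
  have sym: "symmetric_mat (Q i)" if "i < ?n" for i
    using assms(2) that by (simp add: pos_def_def)
  interpret stable_polynomial ?n "\<lambda>i x. x \<bullet> (Q i *v x)" "{x. x \<noteq> 0}" \<alpha> "det_pencil Q"
  proof
    show "1 \<le> \<alpha>" by (rule assms(1))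
    show "0 < x \<bullet> (Q i *v x)" if "i < ?n" "x \<in> {x. x \<noteq> 0}" for i x
      using assms(2) that by (simp add: pos_def_def)
    show "x \<bullet> (Q i *v x) \<le> \<alpha> * (x \<bullet> (Q l *v x))" if "i < ?n" "l < ?n" "x \<in> {x. x \<noteq> 0}" for i l x
    proof -
      \<comment> \<open>Conditioning of eigenvalues becomes comparison of forms through the Rayleigh
        bounds.\<close>
      have "x \<bullet> (Q i *v x) \<le> lambda_max (Q i) * (x \<bullet> x)"
        by (rule inner_le_lambda_max[OF sym[OF that(1)]])
      also have "\<dots> \<le> \<alpha> * lambda_min (Q l) * (x \<bullet> x)"
        using assms(4) that by (intro mult_right_mono) (auto simp: alpha_conditioned_def)
      also have "\<dots> \<le> \<alpha> * (x \<bullet> (Q l *v x))"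
        using lambda_min_le_inner[OF sym[OF that(2)], of x] assms(1) by (simp add: mult.assoc)
      finally show ?thesis .
    qed
    show "real_polyfun (det_pencil Q)" by (rule real_polyfun_det_pencil)
    show "det_pencil Q (\<lambda>i. c * z i) = c ^ ?n * det_pencil Q z" for c z
      by (rule det_pencil_scale)
    show "det_pencil Q z \<noteq> 0"
      if "\<And>x. x \<in> {x. x \<noteq> 0} \<Longrightarrow> 0 < (\<Sum>i<?n. Re (z i) * (x \<bullet> (Q i *v x)))" for z
      using that by (intro det_pencil_nonzero sym) auto
    \<comment> \<open>The matrices sum to the identity, which normalises the polynomial to 1 at the
      all-ones point.\<close>
    have "(\<Sum>i<?n. (if i < ?n then 1 else 0) *\<^sub>R Q i) = mat 1"
      using assms(3) by (simp add: doubly_stochastic_def)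
    then show "det_pencil Q (\<lambda>i. if i < ?n then 1 else 0) = 1"
      using det_pencil_of_real[of Q "\<lambda>i. if i < ?n then 1 else 0"]
      by (simp add: if_distrib[of complex_of_real] cong: if_cong)
  qed
  have "mixed_discr Q = g ?n (\<lambda>_. 0)"
    using pderivs_iter_partial[OF real_polyfun_det_pencil[of Q], of ?n "\<lambda>_. 0"]
    by (simp add: mixed_discr_def det_pencil_of_real)
  also have "\<dots> \<le> exp (\<alpha>\<^sup>2 * (\<Sum>i<?n - 1. 1 / real (?n - i)) - (real ?n - 1))"
    using coefficient_bound by simp
  \<comment> \<open>The recursion yields exponent \<open>\<alpha>\<^sup>2\<close>;
    \<open>\<alpha> \<ge> 1\<close> and a nonnegative logarithm relax it to
    \<open>\<alpha> ^ 4\<close>.\<close>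
  also have "\<dots> \<le> exp (\<alpha> ^ 4 * ln (real ?n) - (real ?n - 1))"
  proof -
    have "\<alpha>\<^sup>2 * (\<Sum>i<?n - 1. 1 / real (?n - i)) \<le> \<alpha>\<^sup>2 * ln (real ?n)"
      using sum_inverse_reverse_le_ln[of ?n] by (intro mult_left_mono) auto
    also have "\<dots> \<le> \<alpha> ^ 4 * ln (real ?n)"
      using assms(1) by (intro mult_right_mono power_increasing) (auto simp: Suc_le_eq)
    finally show ?thesis by simp
  qed
  also have "\<dots> = real ?n powr (\<alpha> ^ 4) * exp (- (real ?n - 1))"
    by (simp add: powr_def exp_add[symmetric])
  finally show ?thesis .
qed

end
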